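(* The ball tangle invariant $f$, from the class of ball tangle diagrams to $PM_{2\times1}(\mathbb Z)$, is onto: for all integers $p,q$ there is a ball tangle diagram $B$ with $f(B)=\left[\begin{matrix} p\\ q\end{matrix}\right]$.
   Context: A ball tangle is a properly embedded compact 1-submanifold of a closed 3-ball (two arcs, possibly together with some circles) whose boundary consists of four fixed points NW, NE, SW, SE of the boundary sphere lying in the projection plane; it is represented by diagrams. Kauffman bracket: let $A=e^{i\pi/4}$ and $\Phi=\{z\in\mathbb C:z^8=1\}$. At a crossing of a link diagram the two regions swept by rotating the over-strand counterclockwise are the $A$-regions, the other two the $B$-regions; $A$-type (resp. $B$-type) splitting opens a channel joining the two $A$-regions (resp. $B$-regions). A state $\sigma$ chooses a splitting at each crossing; $\alpha(\sigma),\beta(\sigma)$ are the numbers of $A$-type and $B$-type splittings and $d(\sigma)$ the number of resulting circles. $\langle L\rangle=\sum_{\sigma:\,d(\sigma)=1}A^{\alpha(\sigma)-\beta(\sigma)}$. For a ball tangle diagram $B$, the numerator closure $B_1$ joins NW to NE and SW to SE by arcs outside the ball without crossings; the denominator closure $B_2$ joins NW to SW and NE to SE. The invariant is $f(B)=\left\{\begin{pmatrix} z\langle B_1\rangle\\ iz\langle B_2\rangle\end{pmatrix}:z\in\Phi\right\}\cap M_{2\times1}(\mathbb Z)$, which is a set of the form $\{v,-v\}$, i.e. an element of $PM_{2\times1}(\mathbb Z)=M_{2\times1}(\mathbb Z)/\pm1$; $\left[\begin{matrix} p\\ q\end{matrix}\right]$ denotes the class of $(p,q)^T$ modulo $\pm1$.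 *)

theory Defs
  imports "HOL-Analysis.Analysis"
begin

text \<open>
  Diagrams are piecewise linear and live in the projection plane, identified with the complex
  plane. The underlying plane curve is given by a finite set of edges; an edge is the two-element
  set of its endpoints and its segment is the convex hull of that set. Edges are glued at
  common endpoints only; where two edges meet in interior points they cross.
\<close>

record diagram =
  edges :: "complex set set"
  over :: "complex \<Rightarrow> complex set" \<comment> \<open>over-passing edge at a crossing; irrelevant elsewhere\<close>

definition crossings :: "diagram \<Rightarrow> complex set" where
  "crossings D = {c. \<exists>e\<in>edges D. \<exists>e'\<in>edges D. e \<noteq> e' \<and>
                     c \<in> convex hull e - e \<and> c \<in> convex hull e' - e'}"

text \<open>
  Regular projections: no vertex lies in the interior of an edge (this also excludes overlapping
  edges, so all crossings are transversal), and there are no triple points.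
\<close>

definition regular_diagram :: "diagram \<Rightarrow> bool" where
  "regular_diagram D \<longleftrightarrow>
     finite (edges D) \<and>
     (\<forall>e\<in>edges D. card e = 2) \<and>
     (\<forall>e\<in>edges D. \<forall>e'\<in>edges D. \<forall>x\<in>convex hull e \<inter> convex hull e'. x \<in> e \<longleftrightarrow> x \<in> e') \<and>
     (\<forall>c\<in>crossings D. card {e \<in> edges D. c \<in> convex hull e} = 2 \<and>
                      over D c \<in> edges D \<and> c \<in> convex hull (over D c))"

text \<open>The ball projects to the closed disc of radius \<open>sqrt 2\<close> about the origin.\<close>

definition NW :: complex where "NW = Complex (-1) 1"
definition NE :: complex where "NE = Complex 1 1"
definition SW :: complex where "SW = Complex (-1) (-1)"
definition SE :: complex where "SE = Complex 1 (-1)"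

text \<open>
  The valency condition makes the curve a compact 1-manifold with boundary the four fixed points,
  that is, two arcs and possibly some circles. Since the disc is strictly convex, the
  condition on the vertices implies that the curve meets the bounding circle in these points only.
\<close>

definition ball_tangle_diagram :: "diagram \<Rightarrow> bool" where
  "ball_tangle_diagram B \<longleftrightarrow>
     regular_diagram B \<and>
     {NW, NE, SW, SE} \<subseteq> \<Union>(edges B) \<and>
     (\<forall>v\<in>\<Union>(edges B).
        if v \<in> {NW, NE, SW, SE} then card {e \<in> edges B. v \<in> e} = 1
        else norm v < sqrt 2 \<and> card {e \<in> edges B. v \<in> e} = 2)"

text \<open>
  Each closing arc consists of two edges, which leave the disc at the boundary points
  and meet at distance 3 from the origin.
\<close>

definition numerator_closure :: "diagram \<Rightarrow> diagram" where
  "numerator_closure B = B\<lparr>edges := edges B \<union>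
     {{NW, Complex 0 3}, {Complex 0 3, NE}, {SW, Complex 0 (-3)}, {Complex 0 (-3), SE}}\<rparr>"

definition denominator_closure :: "diagram \<Rightarrow> diagram" where
  "denominator_closure B = B\<lparr>edges := edges B \<union>
     {{NW, Complex (-3) 0}, {Complex (-3) 0, SW}, {NE, Complex 3 0}, {Complex 3 0, SE}}\<rparr>"

text \<open>
  A state is represented by the set \<open>\<sigma>\<close> of crossings that receive the \<open>A\<close>-type splitting.
  At a crossing \<open>c\<close> let \<open>p\<close> and \<open>q\<close> be points at distance \<open>\<epsilon>\<close> from \<open>c\<close> on the over-strand and on the
  under-strand. The sign of \<open>Im (cnj (p - c) * (q - c))\<close> is positive iff \<open>q\<close> lies counterclockwise
  from \<open>p\<close>, i.e. iff the ray through \<open>p\<close> sweeps the region between \<open>p\<close> and \<open>q\<close> when rotated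
  counterclockwise, which is then an \<open>A\<close>-region. Splitting replaces the part of the diagram within
  distance \<open>\<epsilon>\<close> by two chords \<open>pq\<close>; the \<open>A\<close>-type splitting joins the two \<open>A\<close>-regions,
  so its chords lie in the two \<open>B\<close>-regions, and vice versa.
\<close>

definition splitting_arcs :: "diagram \<Rightarrow> complex set \<Rightarrow> real \<Rightarrow> complex \<Rightarrow> complex set" where
  "splitting_arcs D \<sigma> \<epsilon> c = \<Union>{closed_segment p q | p q.
      p \<in> convex hull (over D c) \<and> dist c p = \<epsilon> \<and>
      (\<exists>e\<in>edges D. e \<noteq> over D c \<and> c \<in> convex hull e \<and> q \<in> convex hull e) \<and> dist c q = \<epsilon> \<and>
      (if c \<in> \<sigma> then Im (cnj (p - c) * (q - c)) < 0 else Im (cnj (p - c) * (q - c)) > 0)}"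

definition split_diagram :: "diagram \<Rightarrow> complex set \<Rightarrow> real \<Rightarrow> complex set" where
  "split_diagram D \<sigma> \<epsilon> =
     ((\<Union>e\<in>edges D. convex hull e) - (\<Union>c\<in>crossings D. ball c \<epsilon>)) \<union>
     (\<Union>c\<in>crossings D. splitting_arcs D \<sigma> \<epsilon> c)"

text \<open>The number \<open>d(\<sigma>)\<close> of circles, which is the same for all sufficiently small \<open>\<epsilon> > 0\<close>.\<close>

definition num_circles :: "diagram \<Rightarrow> complex set \<Rightarrow> nat" where
  "num_circles D \<sigma> =
     (THE n. \<forall>\<^sub>F \<epsilon> in at_right 0. card (components (split_diagram D \<sigma> \<epsilon>)) = n)"

definition bracket :: "diagram \<Rightarrow> complex" where
  "bracket D = (\<Sum>\<sigma> | \<sigma> \<subseteq> crossings D \<and> num_circles D \<sigma> = 1.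
     exp (\<i> * of_real pi / 4) powi (int (card \<sigma>) - int (card (crossings D - \<sigma>))))"

definition ball_tangle_invariant :: "diagram \<Rightarrow> (complex ^ 2) set" where
  "ball_tangle_invariant B =
     {vector [z * bracket (numerator_closure B), \<i> * z * bracket (denominator_closure B)] | z.
        z ^ 8 = 1} \<inter> {v. \<forall>j. v $ j \<in> \<int>}"

definition pm_class :: "int \<Rightarrow> int \<Rightarrow> (complex ^ 2) set" where
  "pm_class p q = {vector [of_int p, of_int q], - vector [of_int p, of_int q]}"

end

theory Submission imports Defs begin

text \<open>
  Splitting all crossings of a tangle diagram turns it into two arcs and some circles, and planarity
  is not needed to see that the arcs never join opposite corners: the diagrams used here are built
  from pieces for which this holds. The bracket of the numerator closure therefore sums the states
  without circles whose arcs run vertically, and that of the denominator closure those whose arcs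
  run horizontally. With the factor \<open>z\<close> normalising these sums to \<open>p\<close> and \<open>q\<close>, rotating by a right angle
  sends \<open>(p, q)\<close> to \<open>(q, -p)\<close>, and putting two tangles side by side behaves like
  \<open>p/q + r/s = (p s + q r)/(q s)\<close> without cancellation. The tangle with two horizontal arcs realises
  \<open>(0, 1)\<close> and a single crossing realises \<open>(1, 1)\<close>. Sums with the crossing and rotations perform
  Euclid's algorithm, which ends in some \<open>(d, 0)\<close>; that pair is the sum of \<open>(1, 0)\<close> and \<open>(1, d)\<close>.
\<close>

section \<open>Decompositions into compact connected parts\<close>

text \<open>The count d(\<sigma>) is a number of connected components of a point set, required to be
  constant for all small \<open>\<epsilon>\<close>. Hence the proof tracks connectivity only: a
  split tangle is a list of disjoint compact connected pieces, two of which contain the corners in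
  pairs. That these pieces are arcs or circles is never shown, and the bracket does not see it.
  Euclid's algorithm alone would stay among coprime pairs: adding a crossing and rotating act on (p,
  q) by integer matrices of determinant 1 and preserve the gcd. The other pairs come from the
  uncancelled sum with a tangle whose second entry is 0, which is why gluing two arbitrary tangles
  is developed rather than only gluing a crossing to a tangle. Pairs are tracked with their sign,
  together with a phase; the ambiguity modulo sign returns only when the invariant itself is
  computed.\<close>

definition parts :: "'a::metric_space set list \<Rightarrow> 'a set \<Rightarrow> bool" where
  "parts Xs S \<longleftrightarrow> distinct Xs \<and> disjoint (set Xs) \<and> \<Union>(set Xs) = S \<and>
     (\<forall>X\<in>set Xs. compact X \<and> connected X \<and> X \<noteq> {})"

text \<open>A list has finitely many members, so the union of the remaining parts is closed; a
  connected set covered by two disjoint closed sets stays in the one that it meets.\<close>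

lemma parts_component:
  assumes "parts Xs S" "X \<in> set Xs" "x \<in> X"
  shows "connected_component_set S x = X"
proof
  have dis: "disjoint (set Xs)" and S: "\<Union>(set Xs) = S"
    and cpt: "\<And>X. X \<in> set Xs \<Longrightarrow> compact X \<and> connected X"
    using assms by (auto simp: parts_def)
  let ?C = "connected_component_set S x" and ?Y = "\<Union>(set Xs - {X})"
  have cover: "?C \<subseteq> X \<union> ?Y" using S connected_component_subset[of S x] by auto
  have "closed X" using cpt assms(2) by (simp add: compact_imp_closed)
  moreover have "closed ?Y" using cpt by (intro closed_Union) (auto intro: compact_imp_closed)
  moreover have "X \<inter> ?Y = {}" using dis assms(2) by (auto simp: disjoint_def)
  moreover have "x \<in> ?C" using S assms by auto
  moreover have "connected ?C" by simp
  ultimately have "?Y \<inter> ?C = {}"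
    using cover assms(3) unfolding connected_closed by blast
  then show "?C \<subseteq> X" using cover by blast
  show "X \<subseteq> ?C" using cpt assms S by (intro connected_component_maximal) auto
qed

lemma components_parts:
  assumes "parts Xs S"
  shows "components S = set Xs"
proof (intro equalityI subsetI)
  fix C assume "C \<in> components S"
  then obtain x where x: "x \<in> S" "C = connected_component_set S x" by (auto simp: components_def)
  then obtain X where "X \<in> set Xs" "x \<in> X" using assms by (auto simp: parts_def)
  then show "C \<in> set Xs" using parts_component[OF assms] x by simp
next
  fix X assume X: "X \<in> set Xs"
  then obtain x where "x \<in> X" using assms by (auto simp: parts_def)
  moreover then have "x \<in> S" using X assms by (auto simp: parts_def)
  ultimately show "X \<in> components S"
    using parts_component[OF assms X] unfolding components_def by blast
qed

lemma card_components_parts: "parts Xs S \<Longrightarrow> card (components S) = length Xs"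
  by (simp add: components_parts parts_def distinct_card)

lemma parts_perm: "parts Xs S \<Longrightarrow> mset Xs = mset Ys \<Longrightarrow> parts Ys S"
  unfolding parts_def by (metis mset_eq_imp_distinct_iff mset_eq_setD)

lemma parts_append:
  assumes "parts Xs S" "parts Ys T" "S \<inter> T = {}"
  shows "parts (Xs @ Ys) (S \<union> T)"
proof -
  have sub: "X \<subseteq> S" if "X \<in> set Xs" for X using that assms(1) by (auto simp: parts_def)
  have sub': "Y \<subseteq> T" if "Y \<in> set Ys" for Y using that assms(2) by (auto simp: parts_def)
  have XY: "X \<inter> Y = {}" if "X \<in> set Xs" "Y \<in> set Ys" for X Y
    using sub[OF that(1)] sub'[OF that(2)] assms(3) by blast
  have "set Xs \<inter> set Ys = {}"
  proof (rule ccontr)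
    assume "set Xs \<inter> set Ys \<noteq> {}"
    then obtain X where "X \<in> set Xs" "X \<in> set Ys" by blast
    then have "X = {}" using XY by fastforce
    then show False using \<open>X \<in> set Xs\<close> assms(1) by (auto simp: parts_def)
  qed
  moreover have "disjoint (set Xs \<union> set Ys)"
    using assms(1,2) XY unfolding parts_def disjoint_def by (metis Int_commute Un_iff)
  ultimately show ?thesis using assms(1,2) by (auto simp: parts_def)
qed

text \<open>Since \<open>Z\<close> meets \<open>S\<close> only in the pieces \<open>Xs\<close>, the
  other pieces stay disjoint from it, and \<open>Z\<close> takes the place of all of
  \<open>Xs\<close>. Bridging and attaching an arc are the cases of two pieces and of one.\<close>

lemma parts_merge:
  assumes P: "parts (Xs @ Zs) S" and Xs: "Xs \<noteq> []"
    and Z: "compact Z" "connected Z" "\<Union>(set Xs) \<subseteq> Z" "Z \<inter> S = \<Union>(set Xs)"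
  shows "parts (Z # Zs) (S \<union> Z)"
proof -
  have disP: "disjoint (set (Xs @ Zs))" and dist: "distinct (Xs @ Zs)"
    and S: "\<Union>(set (Xs @ Zs)) = S"
    and ne: "\<And>X. X \<in> set (Xs @ Zs) \<Longrightarrow> compact X \<and> connected X \<and> X \<noteq> {}"
    using P by (auto simp: parts_def)
  have XW: "X \<inter> W = {}" if "X \<in> set Xs" "W \<in> set Zs" for X W
  proof -
    have "X \<noteq> W" using that dist by auto
    then show ?thesis using disP that by (auto simp: disjoint_def)
  qed
  have ZW: "Z \<inter> W = {}" if W: "W \<in> set Zs" for W
  proof -
    have "W \<subseteq> S" using S W by auto
    then have "Z \<inter> W \<subseteq> \<Union>(set Xs)" using Z(4) by blast
    moreover have "\<Union>(set Xs) \<inter> W = {}" using XW W by auto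
    ultimately show ?thesis by blast
  qed
  have "Z \<noteq> {}"
  proof -
    obtain X where "X \<in> set Xs" using Xs by (cases Xs) auto
    then show ?thesis using ne[of X] Z(3) by auto
  qed
  have "Z \<notin> set Zs"
  proof
    assume "Z \<in> set Zs"
    then have "Z = {}" using ZW by fastforce
    then show False using \<open>Z \<noteq> {}\<close> by simp
  qed
  moreover have "disjoint (set (Z # Zs))"
    using disP ZW by (auto simp: disjoint_def)
  moreover have "\<Union>(set (Z # Zs)) = S \<union> Z" using S Z(3) by auto
  ultimately show ?thesis using dist ne Z(1,2) \<open>Z \<noteq> {}\<close> by (auto simp: parts_def)
qed

text \<open>An arc between different pieces lowers their number by one. Counting circles rests on
  the contrast with \<open>parts_attach\<close>, where both ends lie in the same piece and the
  number is kept.\<close>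

lemma parts_bridge:
  assumes P: "parts (X # Y # Zs) S" and L: "compact L" "connected L" "L \<inter> S = {x, y}"
    and xy: "x \<in> X" "y \<in> Y"
  shows "parts ((X \<union> L \<union> Y) # Zs) (S \<union> L)"
proof -
  have XY: "X \<subseteq> S" "Y \<subseteq> S" "compact X" "connected X" "compact Y" "connected Y"
    using P by (auto simp: parts_def)
  have "connected (X \<union> L)" using XY L xy by (intro connected_Un) auto
  then have "connected (X \<union> L \<union> Y)" using XY L xy by (intro connected_Un) auto
  moreover have "L \<inter> S \<subseteq> X \<union> Y" using L(3) xy by simp
  then have "(X \<union> L \<union> Y) \<inter> S = X \<union> Y" using XY(1,2) by blast
  ultimately have "parts ((X \<union> L \<union> Y) # Zs) (S \<union> (X \<union> L \<union> Y))"
    using XY L P by (intro parts_merge[of "[X, Y]"]) (auto intro: compact_Un)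
  moreover have "S \<union> (X \<union> L \<union> Y) = S \<union> L" using XY by blast
  ultimately show ?thesis by simp
qed

text \<open>The ends \<open>x\<close> and \<open>y\<close> may coincide, which covers a tail hanging
  on a piece by one point.\<close>

lemma parts_attach:
  assumes P: "parts (X # Zs) S" and L: "compact L" "connected L" "L \<inter> S = {x, y}"
    and xy: "x \<in> X" "y \<in> X"
  shows "parts ((X \<union> L) # Zs) (S \<union> L)"
proof -
  have XY: "X \<subseteq> S" "compact X" "connected X" using P by (auto simp: parts_def)
  have "connected (X \<union> L)" using XY L xy by (intro connected_Un) auto
  moreover have "L \<inter> S \<subseteq> X" using L(3) xy by simp
  then have "(X \<union> L) \<inter> S = X" using XY(1) by blast
  ultimately have "parts ((X \<union> L) # Zs) (S \<union> (X \<union> L))"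
    using XY L P by (intro parts_merge[of "[X]"]) (auto intro: compact_Un)
  moreover have "S \<union> (X \<union> L) = S \<union> L" using XY by blast
  ultimately show ?thesis by simp
qed

lemma parts_image:
  assumes P: "parts Xs S" and f: "continuous_on UNIV f" "inj f"
  shows "parts (map ((`) f) Xs) (f ` S)"
proof -
  have cont: "continuous_on Z f" for Z using f(1) by (rule continuous_on_subset) simp
  have i: "f ` Z \<inter> f ` W = {}" if "Z \<inter> W = {}" for Z W
    using that f(2) by (metis image_Int image_empty)
  have "inj ((`) f)" using f(2) by (simp add: inj_def inj_image_eq_iff)
  then have "distinct (map ((`) f) Xs)"
    using P by (auto simp: parts_def distinct_map intro: inj_on_subset)
  moreover have "disjoint ((`) f ` set Xs)"
    unfolding disjoint_def
  proof (intro ballI impI)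
    fix U V assume "U \<in> (`) f ` set Xs" "V \<in> (`) f ` set Xs" "U \<noteq> V"
    then obtain Z W where "Z \<in> set Xs" "W \<in> set Xs" "Z \<noteq> W" "U = f ` Z" "V = f ` W" by blast
    moreover then have "Z \<inter> W = {}" using P by (auto simp: parts_def disjoint_def)
    ultimately show "U \<inter> V = {}" using i by simp
  qed
  ultimately show ?thesis
    using P cont by (auto simp: parts_def intro: compact_continuous_image connected_continuous_image)
qed

section \<open>Connectivity of a split tangle: two arcs and further circles\<close>

definition two_arcs :: "nat \<Rightarrow> 'a::metric_space set \<Rightarrow> 'a \<Rightarrow> 'a \<Rightarrow> 'a \<Rightarrow> 'a \<Rightarrow> bool" where
  "two_arcs k S a b c d \<longleftrightarrow> (\<exists>X Y Zs. parts (X # Y # Zs) S \<and> length Zs = k \<and>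
     a \<in> X \<and> b \<in> X \<and> c \<in> Y \<and> d \<in> Y)"

lemma two_arcsE:
  assumes "two_arcs k S a b c d"
  obtains X Y Zs where "parts (X # Y # Zs) S" "length Zs = k" "a \<in> X" "b \<in> X" "c \<in> Y" "d \<in> Y"
  using assms unfolding two_arcs_def by blast

lemma two_arcsI:
  "parts (X # Y # Zs) S \<Longrightarrow> length Zs = k \<Longrightarrow> a \<in> X \<Longrightarrow> b \<in> X \<Longrightarrow> c \<in> Y \<Longrightarrow> d \<in> Y \<Longrightarrow>
    two_arcs k S a b c d"
  unfolding two_arcs_def by blast

lemma two_arcs_card_components: "two_arcs k S a b c d \<Longrightarrow> card (components S) = k + 2"
  by (elim two_arcsE) (simp add: card_components_parts)

lemma two_arcs_mem: "two_arcs k S a b c d \<Longrightarrow> a \<in> S \<and> b \<in> S \<and> c \<in> S \<and> d \<in> S"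
  by (elim two_arcsE) (auto simp: parts_def)

lemma two_arcs_swap: "two_arcs k S a b c d \<Longrightarrow> two_arcs k S c d a b"
  by (elim two_arcsE, rule two_arcsI) (auto intro: parts_perm simp: add_mset_commute)

lemma two_arcs_reverse:
  "two_arcs k S a b c d \<Longrightarrow> two_arcs k S b a c d"
  "two_arcs k S a b c d \<Longrightarrow> two_arcs k S a b d c"
  unfolding two_arcs_def by blast+

text \<open>Components are determined by the set, so \<open>a\<close> and \<open>c\<close> cannot be
  separated in one decomposition and share a piece in another. This makes the type of a state well
  defined.\<close>

lemma two_arcs_exclusive:
  assumes "two_arcs k S a b c d" "two_arcs l S a c b d"
  shows False
proof -
  obtain X Y Zs where P: "parts (X # Y # Zs) S" and ac: "a \<in> X" "c \<in> Y"
    using assms(1) by (rule two_arcsE)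
  obtain X' Y' Zs' where P': "parts (X' # Y' # Zs') S" and "a \<in> X'" "c \<in> X'"
    using assms(2) by (rule two_arcsE)
  then have "X = X'" using parts_component[OF P, of X a] parts_component[OF P', of X' a] ac by simp
  moreover have "X \<inter> Y = {}" using P by (auto simp: parts_def disjoint_def)
  ultimately show False using ac \<open>c \<in> X'\<close> by blast
qed

lemma two_arcs_image:
  assumes "two_arcs k S a b c d" "continuous_on UNIV f" "inj f"
  shows "two_arcs k (f ` S) (f a) (f b) (f c) (f d)"
  using assms(1)
proof (rule two_arcsE)
  fix X Y Zs assume "parts (X # Y # Zs) S" "length Zs = k" "a \<in> X" "b \<in> X" "c \<in> Y" "d \<in> Y"
  then show ?thesis
    using parts_image[OF _ assms(2,3), of "X # Y # Zs"]
    by (intro two_arcsI[of "f ` X" "f ` Y" "map ((`) f) Zs"]) auto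
qed

lemma two_arcs_extend:
  assumes "two_arcs k S a b c d" and L: "compact L" "connected L" "L \<inter> S = {a}" "a' \<in> L"
  shows "two_arcs k (S \<union> L) a' b c d"
  using assms(1)
proof (rule two_arcsE)
  fix X Y Zs assume P: "parts (X # Y # Zs) S" "length Zs = k" "a \<in> X" "b \<in> X" "c \<in> Y" "d \<in> Y"
  have "parts ((X \<union> L) # Y # Zs) (S \<union> L)"
    using parts_attach[OF P(1) L(1,2), of a a] L(3) P(3) by simp
  then show ?thesis by (rule two_arcsI) (use P L in auto)
qed

text \<open>Each closing arc has both ends in the same piece, so the two strands close up
  separately.\<close>

lemma two_arcs_close_parallel:
  assumes "two_arcs k S a b c d" and L: "compact L" "connected L" "L \<inter> S = {a, b}"
    and M: "compact M" "connected M" "M \<inter> S = {c, d}" and LM: "L \<inter> M = {}"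
  shows "card (components (S \<union> (L \<union> M))) = k + 2"
  using assms(1)
proof (rule two_arcsE)
  fix X Y Zs assume P: "parts (X # Y # Zs) S" "length Zs = k" "a \<in> X" "b \<in> X" "c \<in> Y" "d \<in> Y"
  have "parts ((X \<union> L) # Y # Zs) (S \<union> L)" by (rule parts_attach[OF P(1) L P(3,4)])
  then have "parts (Y # (X \<union> L) # Zs) (S \<union> L)" by (rule parts_perm) simp
  moreover have "M \<inter> (S \<union> L) = {c, d}" using M(3) LM by blast
  ultimately have "parts ((Y \<union> M) # (X \<union> L) # Zs) (S \<union> L \<union> M)"
    using M(1,2) P(5,6) by (intro parts_attach)
  then show ?thesis using P(2) by (simp add: card_components_parts Un_assoc)
qed

text \<open>The first closing arc joins the two pieces into one and the second closes it up: one
  piece fewer than in the parallel case.\<close>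

lemma two_arcs_close_across:
  assumes "two_arcs k S a b c d" and L: "compact L" "connected L" "L \<inter> S = {a, c}"
    and M: "compact M" "connected M" "M \<inter> S = {b, d}" and LM: "L \<inter> M = {}"
  shows "card (components (S \<union> (L \<union> M))) = k + 1"
  using assms(1)
proof (rule two_arcsE)
  fix X Y Zs assume P: "parts (X # Y # Zs) S" "length Zs = k" "a \<in> X" "b \<in> X" "c \<in> Y" "d \<in> Y"
  have "parts ((X \<union> L \<union> Y) # Zs) (S \<union> L)" by (rule parts_bridge[OF P(1) L P(3,5)])
  moreover have "M \<inter> (S \<union> L) = {b, d}" using M(3) LM by blast
  ultimately have "parts ((X \<union> L \<union> Y \<union> M) # Zs) (S \<union> L \<union> M)"
    using M(1,2) P(4,6) by (intro parts_attach[of _ _ _ M b d]) simp_all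
  then show ?thesis using P(2) by (simp add: card_components_parts Un_assoc)
qed

text \<open>In the three joins, picture \<open>S\<close> on the left and \<open>T\<close> on the
  right, with \<open>L\<close> joining the upper inner corners and \<open>M\<close> the lower ones.
  Here each horizontal strand on the left continues in one on the right.\<close>

lemma two_arcs_join_HH:
  assumes "two_arcs k S a b c d" "two_arcs l T a' b' c' d'" and ST: "S \<inter> T = {}"
    and L: "compact L" "connected L" "L \<inter> (S \<union> T) = {b, a'}"
    and M: "compact M" "connected M" "M \<inter> (S \<union> T) = {d, c'}" and LM: "L \<inter> M = {}"
  shows "two_arcs (k + l) (S \<union> T \<union> (L \<union> M)) a b' c d'"
  using assms(1)
proof (rule two_arcsE)
  fix X Y Zs assume P: "parts (X # Y # Zs) S" "length Zs = k" "a \<in> X" "b \<in> X" "c \<in> Y" "d \<in> Y"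
  from assms(2) show ?thesis
  proof (rule two_arcsE)
    fix X' Y' Zs' assume P': "parts (X' # Y' # Zs') T" "length Zs' = l"
      "a' \<in> X'" "b' \<in> X'" "c' \<in> Y'" "d' \<in> Y'"
    have "parts (X # X' # Y # Y' # Zs @ Zs') (S \<union> T)"
      by (rule parts_perm[OF parts_append[OF P(1) P'(1) ST]]) simp
    from parts_bridge[OF this L P(4) P'(3)]
    have "parts (Y # Y' # (X \<union> L \<union> X') # Zs @ Zs') (S \<union> T \<union> L)" by (rule parts_perm) simp
    moreover have "M \<inter> (S \<union> T \<union> L) = {d, c'}" using M(3) LM by blast
    ultimately have "parts ((Y \<union> M \<union> Y') # (X \<union> L \<union> X') # Zs @ Zs') (S \<union> T \<union> L \<union> M)"
      using M(1,2) P(6) P'(5) by (intro parts_bridge[of _ _ _ _ M d c']) simp_all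
    then have "parts ((X \<union> L \<union> X') # (Y \<union> M \<union> Y') # Zs @ Zs') (S \<union> T \<union> L \<union> M)"
      by (rule parts_perm) simp
    then show ?thesis by (subst Un_assoc[symmetric], rule two_arcsI) (use P P' in simp_all)
  qed
qed

text \<open>The inner vertical strand of \<open>S\<close> is prolonged at both ends by the
  horizontal strands of \<open>T\<close>; no piece is closed off.\<close>

lemma two_arcs_join_VH:
  assumes "two_arcs k S a b c d" "two_arcs l T a' b' c' d'" and ST: "S \<inter> T = {}"
    and L: "compact L" "connected L" "L \<inter> (S \<union> T) = {c, a'}"
    and M: "compact M" "connected M" "M \<inter> (S \<union> T) = {d, c'}" and LM: "L \<inter> M = {}"
  shows "two_arcs (k + l) (S \<union> T \<union> (L \<union> M)) a b b' d'"
  using assms(1)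
proof (rule two_arcsE)
  fix X Y Zs assume P: "parts (X # Y # Zs) S" "length Zs = k" "a \<in> X" "b \<in> X" "c \<in> Y" "d \<in> Y"
  from assms(2) show ?thesis
  proof (rule two_arcsE)
    fix X' Y' Zs' assume P': "parts (X' # Y' # Zs') T" "length Zs' = l"
      "a' \<in> X'" "b' \<in> X'" "c' \<in> Y'" "d' \<in> Y'"
    have "parts (Y # X' # Y' # X # Zs @ Zs') (S \<union> T)"
      by (rule parts_perm[OF parts_append[OF P(1) P'(1) ST]]) simp
    from parts_bridge[OF this L P(5) P'(3)]
    have "parts ((Y \<union> L \<union> X') # Y' # X # Zs @ Zs') (S \<union> T \<union> L)" .
    moreover have "M \<inter> (S \<union> T \<union> L) = {d, c'}" using M(3) LM by blast
    ultimately have "parts ((Y \<union> L \<union> X' \<union> M \<union> Y') # X # Zs @ Zs') (S \<union> T \<union> L \<union> M)"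
      using M(1,2) P(6) P'(5) by (intro parts_bridge[of _ _ _ _ M d c']) simp_all
    then have "parts (X # (Y \<union> L \<union> X' \<union> M \<union> Y') # Zs @ Zs') (S \<union> T \<union> L \<union> M)"
      by (rule parts_perm) simp
    then show ?thesis by (subst Un_assoc[symmetric], rule two_arcsI) (use P P' in simp_all)
  qed
qed

text \<open>Both connecting arcs join the same two vertical strands, which close up to a circle;
  hence the \<open>Suc\<close>.\<close>

lemma two_arcs_join_VV:
  assumes "two_arcs k S a b c d" "two_arcs l T a' b' c' d'" and ST: "S \<inter> T = {}"
    and L: "compact L" "connected L" "L \<inter> (S \<union> T) = {c, a'}"
    and M: "compact M" "connected M" "M \<inter> (S \<union> T) = {d, b'}" and LM: "L \<inter> M = {}"
  shows "two_arcs (Suc (k + l)) (S \<union> T \<union> (L \<union> M)) a b c' d'"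
  using assms(1)
proof (rule two_arcsE)
  fix X Y Zs assume P: "parts (X # Y # Zs) S" "length Zs = k" "a \<in> X" "b \<in> X" "c \<in> Y" "d \<in> Y"
  from assms(2) show ?thesis
  proof (rule two_arcsE)
    fix X' Y' Zs' assume P': "parts (X' # Y' # Zs') T" "length Zs' = l"
      "a' \<in> X'" "b' \<in> X'" "c' \<in> Y'" "d' \<in> Y'"
    have "parts (Y # X' # Y' # X # Zs @ Zs') (S \<union> T)"
      by (rule parts_perm[OF parts_append[OF P(1) P'(1) ST]]) simp
    from parts_bridge[OF this L P(5) P'(3)]
    have "parts ((Y \<union> L \<union> X') # Y' # X # Zs @ Zs') (S \<union> T \<union> L)" .
    moreover have "M \<inter> (S \<union> T \<union> L) = {d, b'}" using M(3) LM by blast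
    ultimately have "parts ((Y \<union> L \<union> X' \<union> M) # Y' # X # Zs @ Zs') (S \<union> T \<union> L \<union> M)"
      using M(1,2) P(6) P'(4) by (intro parts_attach[of _ _ _ M d b']) simp_all
    then have "parts (X # Y' # (Y \<union> L \<union> X' \<union> M) # Zs @ Zs') (S \<union> T \<union> L \<union> M)"
      by (rule parts_perm) simp
    then show ?thesis by (subst Un_assoc[symmetric], rule two_arcsI) (use P P' in simp_all)
  qed
qed

section \<open>Gluing and transforming diagrams\<close>

definition curve :: "diagram \<Rightarrow> complex set" where
  "curve D = (\<Union>e\<in>edges D. convex hull e)"

definition valency :: "diagram \<Rightarrow> complex \<Rightarrow> nat" where
  "valency D v = card {e \<in> edges D. v \<in> e}"

text \<open>Contact in shared vertices only: gluing then creates no crossing, and near a crossing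
  only one of the two diagrams is present.\<close>

definition compatible :: "diagram \<Rightarrow> diagram \<Rightarrow> bool" where
  "compatible D E \<longleftrightarrow> (\<forall>e\<in>edges D. \<forall>e'\<in>edges E. convex hull e \<inter> convex hull e' \<subseteq> e \<inter> e')"

definition glue :: "diagram \<Rightarrow> diagram \<Rightarrow> diagram" where
  "glue D E = \<lparr>edges = edges D \<union> edges E,
     over = (\<lambda>c. if c \<in> crossings D then over D c else over E c)\<rparr>"

lemma edges_glue [simp]: "edges (glue D E) = edges D \<union> edges E"
  by (simp add: glue_def)

lemma curve_glue [simp]: "curve (glue D E) = curve D \<union> curve E"
  by (simp add: curve_def)

lemma closed_curve: "regular_diagram D \<Longrightarrow> closed (curve D)"
  unfolding curve_def regular_diagram_def
  by (intro closed_UN) (auto intro!: compact_imp_closed finite_imp_compact_convex_hull card_ge_0_finite)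

lemma crossing_in_curve: "c \<in> crossings D \<Longrightarrow> c \<in> curve D"
  by (auto simp: crossings_def curve_def)

lemma regular_over:
  assumes "regular_diagram D" "c \<in> crossings D"
  shows "over D c \<in> edges D" "c \<in> convex hull over D c"
  using assms by (auto simp: regular_diagram_def)

lemma regular_vertex:
  assumes "regular_diagram D" "e \<in> edges D" "v \<in> convex hull e" "v \<in> \<Union>(edges D)"
  shows "v \<in> e"
proof -
  obtain e' where e': "e' \<in> edges D" "v \<in> e'" using assms(4) by blast
  then have "v \<in> convex hull e'" by (simp add: hull_inc)
  then have "v \<in> convex hull e \<inter> convex hull e'" using assms(3) by simp
  moreover have "\<forall>e\<in>edges D. \<forall>e'\<in>edges D. \<forall>x\<in>convex hull e \<inter> convex hull e'. x \<in> e \<longleftrightarrow> x \<in> e'"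
    using assms(1) unfolding regular_diagram_def by blast
  ultimately show ?thesis using e' assms(2) by blast
qed

locale gluing =
  fixes D E :: diagram
  assumes D: "regular_diagram D" and E: "regular_diagram E" and DE: "compatible D E"
begin

lemma meet:
  assumes "e \<in> edges D" "e' \<in> edges E" "x \<in> convex hull e" "x \<in> convex hull e'"
  shows "x \<in> e" "x \<in> e'"
  using assms DE unfolding compatible_def by blast+

text \<open>The midpoint of a shared edge would have to be one of its endpoints. Disjointness makes
  valencies add up.\<close>

lemma edges_disjoint: "edges D \<inter> edges E = {}"
proof (rule ccontr)
  assume "edges D \<inter> edges E \<noteq> {}"
  then obtain e where e: "e \<in> edges D" "e \<in> edges E" by blast
  then have "card e = 2" using D by (simp add: regular_diagram_def)
  then obtain x y where xy: "e = {x, y}" "x \<noteq> y" by (meson card_2_iff)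
  have "midpoint x y \<in> convex hull e"
    using xy by (metis midpoint_in_closed_segment segment_convex_hull)
  then have "midpoint x y \<in> e" using meet e by blast
  then show False using xy by (auto simp: midpoint_eq_endpoint)
qed

text \<open>A crossing lies in the interior of an edge, whereas every contact of the two diagrams is
  a vertex.\<close>

lemma crossings_off: "c \<in> crossings D \<Longrightarrow> c \<notin> curve E" "c \<in> crossings E \<Longrightarrow> c \<notin> curve D"
proof -
  show "c \<notin> curve E" if c: "c \<in> crossings D"
  proof
    assume "c \<in> curve E"
    then obtain e' where e': "e' \<in> edges E" "c \<in> convex hull e'" by (auto simp: curve_def)
    obtain e where e: "e \<in> edges D" "c \<in> convex hull e" "c \<notin> e" using c by (auto simp: crossings_def)
    show False using meet(1)[OF e(1) e'(1) e(2) e'(2)] e(3) by simp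
  qed
  show "c \<notin> curve D" if c: "c \<in> crossings E"
  proof
    assume "c \<in> curve D"
    then obtain e' where e': "e' \<in> edges D" "c \<in> convex hull e'" by (auto simp: curve_def)
    obtain e where e: "e \<in> edges E" "c \<in> convex hull e" "c \<notin> e" using c by (auto simp: crossings_def)
    show False using meet(2)[OF e'(1) e(1) e'(2) e(2)] e(3) by simp
  qed
qed

lemma crossings_disjoint: "crossings D \<inter> crossings E = {}"
  using crossings_off crossing_in_curve by blast

lemma crossings_glue: "crossings (glue D E) = crossings D \<union> crossings E"
proof
  show "crossings D \<union> crossings E \<subseteq> crossings (glue D E)"
    unfolding crossings_def edges_glue by blast
  show "crossings (glue D E) \<subseteq> crossings D \<union> crossings E"
  proof
    fix c assume "c \<in> crossings (glue D E)"
    then obtain e e' where e: "e \<in> edges D \<union> edges E" "e' \<in> edges D \<union> edges E" "e \<noteq> e'"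
      "c \<in> convex hull e" "c \<notin> e" "c \<in> convex hull e'" "c \<notin> e'"
      by (auto simp: crossings_def)
    then have "e \<in> edges D \<and> e' \<in> edges D \<or> e \<in> edges E \<and> e' \<in> edges E"
      using meet by blast
    then have "c \<in> crossings D \<or> c \<in> crossings E"
      using e(3-7) unfolding crossings_def mem_Collect_eq by (metis Diff_iff)
    then show "c \<in> crossings D \<union> crossings E" by simp
  qed
qed

lemma edges_at_crossing:
  "c \<in> crossings D \<Longrightarrow> e \<in> edges E \<Longrightarrow> c \<notin> convex hull e"
  "c \<in> crossings E \<Longrightarrow> e \<in> edges D \<Longrightarrow> c \<notin> convex hull e"
  using crossings_off by (auto simp: curve_def)

lemma over_glue:
  "c \<in> crossings D \<Longrightarrow> over (glue D E) c = over D c"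
  "c \<in> crossings E \<Longrightarrow> over (glue D E) c = over E c"
  using crossings_disjoint by (auto simp: glue_def)

lemma regular_glue: "regular_diagram (glue D E)"
proof -
  have "card {e \<in> edges D \<union> edges E. c \<in> convex hull e} = 2" if c: "c \<in> crossings D \<union> crossings E" for c
  proof (cases "c \<in> crossings D")
    case True
    then have "{e \<in> edges D \<union> edges E. c \<in> convex hull e} = {e \<in> edges D. c \<in> convex hull e}"
      using edges_at_crossing by auto
    then show ?thesis using D True by (simp add: regular_diagram_def)
  next
    case False
    then have "{e \<in> edges D \<union> edges E. c \<in> convex hull e} = {e \<in> edges E. c \<in> convex hull e}"
      using edges_at_crossing c by auto
    then show ?thesis using E False c by (simp add: regular_diagram_def)
  qed
  moreover have "x \<in> e \<longleftrightarrow> x \<in> e'" if h: "e \<in> edges D \<union> edges E" "e' \<in> edges D \<union> edges E"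
    "x \<in> convex hull e \<inter> convex hull e'" for e e' x
  proof -
    consider "e \<in> edges D" "e' \<in> edges D" | "e \<in> edges E" "e' \<in> edges E"
      | "e \<in> edges D" "e' \<in> edges E" | "e \<in> edges E" "e' \<in> edges D" using h by blast
    then show ?thesis
    proof cases
      case 1 then show ?thesis using D h(3) unfolding regular_diagram_def by blast
    next
      case 2 then show ?thesis using E h(3) unfolding regular_diagram_def by blast
    next
      case 3 then show ?thesis using meet h(3) by blast
    next
      case 4 then show ?thesis using meet h(3) by blast
    qed
  qed
  moreover have "over (glue D E) c \<in> edges D \<union> edges E \<and> c \<in> convex hull (over (glue D E) c)"
    if "c \<in> crossings D \<union> crossings E" for c
    using that over_glue regular_over[OF D] regular_over[OF E] by fastforce
  moreover have "finite (edges D \<union> edges E)" "\<forall>e\<in>edges D \<union> edges E. card e = 2"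
    using D E by (auto simp: regular_diagram_def)
  ultimately show ?thesis unfolding regular_diagram_def crossings_glue edges_glue by blast
qed

lemma valency_glue: "valency (glue D E) v = valency D v + valency E v"
proof -
  have "{e \<in> edges (glue D E). v \<in> e} = {e \<in> edges D. v \<in> e} \<union> {e \<in> edges E. v \<in> e}" by auto
  moreover have "finite (edges D)" "finite (edges E)" using D E by (auto simp: regular_diagram_def)
  ultimately show ?thesis unfolding valency_def
    using edges_disjoint by (simp, intro card_Un_disjoint) auto
qed

lemma splitting_arcs_glue:
  "c \<in> crossings D \<Longrightarrow> splitting_arcs (glue D E) \<sigma> \<epsilon> c = splitting_arcs D \<sigma> \<epsilon> c"
  "c \<in> crossings E \<Longrightarrow> splitting_arcs (glue D E) \<sigma> \<epsilon> c = splitting_arcs E \<sigma> \<epsilon> c"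
proof -
  assume c: "c \<in> crossings D"
  have "(\<exists>e\<in>edges (glue D E). e \<noteq> over D c \<and> c \<in> convex hull e \<and> q \<in> convex hull e) \<longleftrightarrow>
    (\<exists>e\<in>edges D. e \<noteq> over D c \<and> c \<in> convex hull e \<and> q \<in> convex hull e)" for q
    using edges_at_crossing(1)[OF c] by auto
  then show "splitting_arcs (glue D E) \<sigma> \<epsilon> c = splitting_arcs D \<sigma> \<epsilon> c"
    unfolding splitting_arcs_def over_glue(1)[OF c] by presburger
next
  assume c: "c \<in> crossings E"
  have "(\<exists>e\<in>edges (glue D E). e \<noteq> over E c \<and> c \<in> convex hull e \<and> q \<in> convex hull e) \<longleftrightarrow>
    (\<exists>e\<in>edges E. e \<noteq> over E c \<and> c \<in> convex hull e \<and> q \<in> convex hull e)" for q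
    using edges_at_crossing(2)[OF c] by auto
  then show "splitting_arcs (glue D E) \<sigma> \<epsilon> c = splitting_arcs E \<sigma> \<epsilon> c"
    unfolding splitting_arcs_def over_glue(2)[OF c] by presburger
qed

text \<open>The balls removed at the crossings of one diagram must miss the curve of the other. That
  curve is closed and avoids these finitely many points, so small \<open>\<epsilon>\<close>
  suffice.\<close>

lemma eventually_split_glue:
  assumes "finite (crossings D)" "finite (crossings E)"
  shows "\<forall>\<^sub>F \<epsilon> in at_right 0.
    split_diagram (glue D E) \<sigma> \<epsilon> = split_diagram D \<sigma> \<epsilon> \<union> split_diagram E \<sigma> \<epsilon>"
proof -
  have off: "\<forall>\<^sub>F \<epsilon> in at_right 0. ball c \<epsilon> \<inter> K = {}" if "closed K" "c \<notin> K" for c :: complex and K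
  proof -
    have "open (- K)" "c \<in> - K" using that by auto
    then obtain r where r: "r > 0" "ball c r \<subseteq> - K" by (meson openE)
    show ?thesis
      unfolding eventually_at_right_field
    proof (intro exI[of _ r] conjI allI impI)
      fix \<epsilon> :: real assume "0 < \<epsilon>" "\<epsilon> < r"
      then have "ball c \<epsilon> \<subseteq> ball c r" by (intro subset_ball) simp
      then show "ball c \<epsilon> \<inter> K = {}" using r by blast
    qed (fact r)
  qed
  have "\<forall>\<^sub>F \<epsilon> in at_right 0. \<forall>c\<in>crossings D. ball c \<epsilon> \<inter> curve E = {}"
    using assms crossings_off closed_curve[OF E] by (intro eventually_ball_finite) (auto intro: off)
  moreover have "\<forall>\<^sub>F \<epsilon> in at_right 0. \<forall>c\<in>crossings E. ball c \<epsilon> \<inter> curve D = {}"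
    using assms crossings_off closed_curve[OF D] by (intro eventually_ball_finite) (auto intro: off)
  ultimately show ?thesis
  proof eventually_elim
    case (elim \<epsilon>)
    let ?U = "\<Union>c\<in>crossings D. ball c \<epsilon>" and ?V = "\<Union>c\<in>crossings E. ball c \<epsilon>"
    have "?U \<inter> curve E = {}" "?V \<inter> curve D = {}" using elim by blast+
    then have "(curve D \<union> curve E) - (?U \<union> ?V) = (curve D - ?U) \<union> (curve E - ?V)" by blast
    moreover have "(\<Union>c\<in>crossings D \<union> crossings E. splitting_arcs (glue D E) \<sigma> \<epsilon> c) =
      (\<Union>c\<in>crossings D. splitting_arcs D \<sigma> \<epsilon> c) \<union> (\<Union>c\<in>crossings E. splitting_arcs E \<sigma> \<epsilon> c)"
      by (simp add: UN_Un splitting_arcs_glue)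
    ultimately show ?case
      unfolding split_diagram_def curve_def[symmetric] crossings_glue curve_glue
      by (simp only: UN_Un Un_ac)
  qed
qed

end

text \<open>Chords of a splitting have their ends on the curve, so convexity keeps them in
  \<open>K\<close>. This confines a split tangle to its disc for every
  \<open>\<epsilon>\<close>.\<close>

lemma split_diagram_subset:
  assumes "regular_diagram D" "curve D \<subseteq> K" "convex K"
  shows "split_diagram D \<sigma> \<epsilon> \<subseteq> K"
proof -
  have "splitting_arcs D \<sigma> \<epsilon> c \<subseteq> K" if c: "c \<in> crossings D" for c
  proof -
    have "convex hull (over D c) \<subseteq> K" using regular_over[OF assms(1) c] assms(2) by (auto simp: curve_def)
    moreover have "convex hull e \<subseteq> K" if "e \<in> edges D" for e using that assms(2) by (auto simp: curve_def)
    ultimately show ?thesis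
      unfolding splitting_arcs_def by (intro Union_least) (blast dest: closed_segment_subset[OF _ _ assms(3)])
  qed
  then show ?thesis unfolding split_diagram_def curve_def[symmetric] using assms(2) by auto
qed

lemma split_diagram_no_crossings: "crossings D = {} \<Longrightarrow> split_diagram D \<sigma> \<epsilon> = curve D"
  by (simp add: split_diagram_def curve_def)

text \<open>Lets a state of a glued diagram be replaced by its restriction to one factor.\<close>

lemma split_diagram_cong:
  assumes "\<sigma> \<inter> crossings D = \<tau> \<inter> crossings D"
  shows "split_diagram D \<sigma> \<epsilon> = split_diagram D \<tau> \<epsilon>"
proof -
  have "splitting_arcs D \<sigma> \<epsilon> c = splitting_arcs D \<tau> \<epsilon> c" if "c \<in> crossings D" for c
  proof -
    have "c \<in> \<sigma> \<longleftrightarrow> c \<in> \<tau>" using assms that by blast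
    then show ?thesis by (simp add: splitting_arcs_def)
  qed
  then show ?thesis by (simp add: split_diagram_def)
qed

section \<open>Similar copies of diagrams\<close>

locale similarity =
  fixes a b :: complex
  assumes a: "a \<noteq> 0"
begin

text \<open>A complex affine map preserves orientation; a conjugation would interchange
  \<open>A\<close>- and \<open>B\<close>-splittings.\<close>

definition f :: "complex \<Rightarrow> complex" where "f z = a * z + b"

definition transform :: "diagram \<Rightarrow> diagram" where
  "transform D = \<lparr>edges = (`) f ` edges D, over = (\<lambda>c. f ` over D ((c - b) / a))\<rparr>"

lemma edges_transform [simp]: "edges (transform D) = (`) f ` edges D"
  by (simp add: transform_def)

lemma over_transform [simp]: "over (transform D) (f c) = f ` over D c"
  using a by (simp add: transform_def f_def)

lemma inj_f: "inj f"
  using a by (simp add: inj_def f_def)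

lemma surj_f: "surj f"
  using a by (intro surjI[of _ "\<lambda>z. (z - b) / a"]) (simp add: f_def)

lemma continuous_f: "continuous_on X f"
  unfolding f_def by (intro continuous_intros)

lemma f_eq_iff [simp]: "f x = f y \<longleftrightarrow> x = y"
  using inj_f by (auto simp: inj_def)

lemma f_mem_iff [simp]: "f x \<in> f ` S \<longleftrightarrow> x \<in> S"
  by auto

lemma f_image_eq_iff [simp]: "f ` S = f ` T \<longleftrightarrow> S = T"
  using inj_f by (simp add: inj_image_eq_iff)

lemma dist_f [simp]: "dist (f x) (f y) = cmod a * dist x y"
  by (simp add: dist_norm f_def norm_mult[symmetric] algebra_simps)

lemma hull_f [simp]: "convex hull (f ` S) = f ` (convex hull S)"
proof -
  have "f ` T = (+) b ` ((*) a ` T)" for T by (simp add: image_image f_def add.commute)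
  moreover have "linear ((*) a)" by (rule bounded_linear.linear) (rule bounded_linear_mult_right)
  ultimately show ?thesis by (simp only: convex_hull_translation convex_hull_linear_image)
qed

lemma segment_f: "closed_segment (f x) (f y) = f ` closed_segment x y"
  using hull_f[of "{x, y}"] by (simp add: segment_convex_hull)

lemma curve_transform: "curve (transform D) = f ` curve D"
  by (auto simp: curve_def)

lemma crossings_transform: "crossings (transform D) = f ` crossings D"
proof (intro equalityI subsetI)
  fix c assume c: "c \<in> crossings (transform D)"
  obtain c' where c': "c = f c'" using surj_f by (metis surj_def)
  then show "c \<in> f ` crossings D" using c by (auto simp: crossings_def)
next
  fix c assume "c \<in> f ` crossings D"
  then obtain c' e e' where "c = f c'" "e \<in> edges D" "e' \<in> edges D" "e \<noteq> e'"
    "c' \<in> convex hull e - e" "c' \<in> convex hull e' - e'"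
    by (auto simp: crossings_def)
  then have "f ` e \<in> edges (transform D)" "f ` e' \<in> edges (transform D)" "f ` e \<noteq> f ` e'"
    "c \<in> convex hull (f ` e) - f ` e" "c \<in> convex hull (f ` e') - f ` e'"
    by simp_all
  then show "c \<in> crossings (transform D)" unfolding crossings_def by blast
qed

lemma card_f [simp]: "card (f ` S) = card S"
  using inj_f by (metis card_image inj_on_subset subset_UNIV)

lemma card_edges_transform: "card ((`) f ` Es) = card Es"
  by (rule card_image) (simp add: inj_on_def)

lemma valency_transform: "valency (transform D) (f v) = valency D v"
proof -
  have "{e \<in> edges (transform D). f v \<in> e} = (`) f ` {e \<in> edges D. v \<in> e}" by auto
  then show ?thesis by (simp add: valency_def card_edges_transform)
qed

lemma regular_transform:
  assumes D: "regular_diagram D"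
  shows "regular_diagram (transform D)"
proof -
  have "finite (edges (transform D))" "\<forall>e\<in>edges (transform D). card e = 2"
    using D by (auto simp: regular_diagram_def)
  moreover have "x \<in> e \<longleftrightarrow> x \<in> e'"
    if h: "e \<in> edges (transform D)" "e' \<in> edges (transform D)" "x \<in> convex hull e \<inter> convex hull e'" for e e' x
  proof -
    obtain d d' where d: "d \<in> edges D" "d' \<in> edges D" "e = f ` d" "e' = f ` d'" using h by auto
    obtain y where y: "x = f y" using surj_f by (metis surj_def)
    have "y \<in> convex hull d \<inter> convex hull d'" using that(3) d y by simp
    then have "y \<in> d \<longleftrightarrow> y \<in> d'" using D d unfolding regular_diagram_def by blast
    then show ?thesis using d y by simp
  qed
  moreover have "card {e \<in> edges (transform D). c \<in> convex hull e} = 2 \<and>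
      over (transform D) c \<in> edges (transform D) \<and> c \<in> convex hull (over (transform D) c)"
    if h: "c \<in> crossings (transform D)" for c
  proof -
    obtain c' where c': "c = f c'" "c' \<in> crossings D" using h by (auto simp: crossings_transform)
    then have "{e \<in> edges (transform D). c \<in> convex hull e} = (`) f ` {e \<in> edges D. c' \<in> convex hull e}"
      by auto
    then show ?thesis using D c' by (simp add: card_edges_transform regular_diagram_def)
  qed
  ultimately show ?thesis unfolding regular_diagram_def by blast
qed

text \<open>The orientation test is multiplied by the square of \<open>cmod a\<close>, so its sign,
  and with it the kind of splitting, survives. Distances are scaled, hence the radius
  \<open>cmod a * \<epsilon>\<close>.\<close>

lemma splitting_arcs_transform:
  "splitting_arcs (transform D) (f ` \<sigma>) (cmod a * \<epsilon>) (f c) = f ` splitting_arcs D \<sigma> \<epsilon> c"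
proof -
  let ?R = "\<lambda>p q. p \<in> convex hull (over D c) \<and> dist c p = \<epsilon> \<and>
      (\<exists>e\<in>edges D. e \<noteq> over D c \<and> c \<in> convex hull e \<and> q \<in> convex hull e) \<and> dist c q = \<epsilon> \<and>
      (if c \<in> \<sigma> then Im (cnj (p - c) * (q - c)) < 0 else Im (cnj (p - c) * (q - c)) > 0)"
  let ?R' = "\<lambda>p q. p \<in> convex hull (over (transform D) (f c)) \<and> dist (f c) p = cmod a * \<epsilon> \<and>
      (\<exists>e\<in>edges (transform D). e \<noteq> over (transform D) (f c) \<and> f c \<in> convex hull e \<and> q \<in> convex hull e) \<and>
      dist (f c) q = cmod a * \<epsilon> \<and>
      (if f c \<in> f ` \<sigma> then Im (cnj (p - f c) * (q - f c)) < 0 else Im (cnj (p - f c) * (q - f c)) > 0)"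
  have sgn: "Im (cnj (f p - f c) * (f q - f c)) = (cmod a)\<^sup>2 * Im (cnj (p - c) * (q - c))" for p q
  proof -
    have "cnj (f p - f c) * (f q - f c) = (a * cnj a) * (cnj (p - c) * (q - c))"
      by (simp add: f_def algebra_simps)
    also have "\<dots> = of_real ((cmod a)\<^sup>2) * (cnj (p - c) * (q - c))"
      by (simp only: complex_norm_square)
    finally show ?thesis by (simp only: Re_complex_of_real Im_complex_of_real times_complex.sel mult_zero_left add_0_right)
  qed
  have pos: "(cmod a)\<^sup>2 > 0" using a by simp
  have R: "?R' (f p) (f q) \<longleftrightarrow> ?R p q" for p q
    unfolding sgn using a pos by (auto simp: zero_less_mult_iff mult_less_0_iff)
  have "splitting_arcs (transform D) (f ` \<sigma>) (cmod a * \<epsilon>) (f c) =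
      \<Union>{closed_segment p q |p q. ?R' p q}" unfolding splitting_arcs_def by simp
  also have "\<dots> = (\<Union>p. \<Union>q\<in>{q. ?R' p q}. closed_segment p q)" by blast
  \<comment> \<open>By surjectivity all chord ends can be written as images under \<open>f\<close>,
    which turns the condition \<open>?R'\<close> into \<open>?R\<close>.\<close>
  also have "\<dots> = (\<Union>p\<in>range f. \<Union>q\<in>{q\<in>range f. ?R' p q}. closed_segment p q)"
    by (simp only: surj_f) simp
  also have "\<dots> = (\<Union>p. \<Union>q\<in>{q. ?R' (f p) (f q)}. f ` closed_segment p q)"
    unfolding segment_f[symmetric] by blast
  also have "\<dots> = f ` \<Union>{closed_segment p q |p q. ?R p q}" unfolding R by blast
  finally show ?thesis unfolding splitting_arcs_def .
qed

lemma ball_f: "f ` ball c r = ball (f c) (cmod a * r)"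
proof (intro equalityI subsetI)
  fix z assume z: "z \<in> ball (f c) (cmod a * r)"
  obtain w where "z = f w" using surj_f by (metis surj_def)
  then show "z \<in> f ` ball c r" using z a by simp
qed (use a in auto)

lemma split_transform:
  "split_diagram (transform D) (f ` \<sigma>) (cmod a * \<epsilon>) = f ` split_diagram D \<sigma> \<epsilon>"
proof -
  have "(\<Union>c\<in>crossings D. ball (f c) (cmod a * \<epsilon>)) = f ` (\<Union>c\<in>crossings D. ball c \<epsilon>)"
    by (simp add: ball_f[symmetric] image_UN)
  then show ?thesis
    unfolding split_diagram_def curve_def[symmetric] curve_transform crossings_transform
    using inj_f by (simp add: splitting_arcs_transform image_Un image_UN image_set_diff)
qed

text \<open>A splitting radius in the copy is \<open>cmod a\<close> times one in the original; a
  statement about all small radii survives this change of scale.\<close>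

lemma eventually_scale:
  assumes "\<forall>\<^sub>F \<epsilon> in at_right 0. P \<epsilon>"
  shows "\<forall>\<^sub>F \<epsilon> in at_right 0. P (\<epsilon> / cmod a)"
proof -
  obtain r where r: "r > 0" "\<And>\<epsilon>. 0 < \<epsilon> \<Longrightarrow> \<epsilon> < r \<Longrightarrow> P \<epsilon>"
    using assms unfolding eventually_at_right_field by blast
  show ?thesis unfolding eventually_at_right_field
    using a r by (intro exI[of _ "r * cmod a"]) (auto simp: field_simps)
qed

lemma eventually_two_arcs_transform:
  assumes "\<forall>\<^sub>F \<epsilon> in at_right 0. two_arcs k (split_diagram D \<sigma> \<epsilon>) x y z w"
  shows "\<forall>\<^sub>F \<epsilon> in at_right 0. two_arcs k (split_diagram (transform D) (f ` \<sigma>) \<epsilon>) (f x) (f y) (f z) (f w)"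
  using eventually_scale[OF assms]
proof eventually_elim
  case (elim \<epsilon>)
  have "split_diagram (transform D) (f ` \<sigma>) \<epsilon> = f ` split_diagram D \<sigma> (\<epsilon> / cmod a)"
    using split_transform[of D \<sigma> "\<epsilon> / cmod a"] a by simp
  then show ?case using two_arcs_image[OF elim continuous_f inj_f] by simp
qed

end

section \<open>Closures of tangles\<close>

lemma segment_box:
  assumes "z \<in> closed_segment u v"
  shows "min (Re u) (Re v) \<le> Re z \<and> Re z \<le> max (Re u) (Re v) \<and>
    min (Im u) (Im v) \<le> Im z \<and> Im z \<le> max (Im u) (Im v)"
proof -
  obtain t where t: "0 \<le> t" "t \<le> 1" "z = (1 - t) *\<^sub>R u + t *\<^sub>R v"
    using assms by (auto simp: in_segment)
  have "min x y \<le> (1 - t) * x + t * y \<and> (1 - t) * x + t * y \<le> max x y" for x y :: real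
  proof -
    have "(1 - t) * min x y + t * min x y \<le> (1 - t) * x + t * y"
      using t by (intro add_mono mult_left_mono) auto
    moreover have "(1 - t) * x + t * y \<le> (1 - t) * max x y + t * max x y"
      using t by (intro add_mono mult_left_mono) auto
    ultimately show ?thesis by (simp add: algebra_simps)
  qed
  then show ?thesis using t(3) by auto
qed

text \<open>The functional that sends x to \<open>(x - m) \<bullet> w\<close> is nonpositive on one
  segment, nonnegative on the other, and vanishes on either only at \<open>m\<close>.\<close>

lemma segments_meet_at_endpoint:
  fixes m :: "'a::real_inner"
  assumes "(u - m) \<bullet> w < 0" "(v - m) \<bullet> w > 0"
  shows "closed_segment u m \<inter> closed_segment m v \<subseteq> {m}"
proof
  fix z assume z: "z \<in> closed_segment u m \<inter> closed_segment m v"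
  obtain s where s: "0 \<le> s" "z = (1 - s) *\<^sub>R m + s *\<^sub>R u"
    using z by (auto simp: closed_segment_commute[of u] in_segment)
  obtain t where t: "0 \<le> t" "z = (1 - t) *\<^sub>R m + t *\<^sub>R v" using z by (auto simp: in_segment)
  have "z - m = s *\<^sub>R (u - m)" unfolding s(2) by (simp add: algebra_simps)
  moreover have "z - m = t *\<^sub>R (v - m)" unfolding t(2) by (simp add: algebra_simps)
  ultimately have "s * ((u - m) \<bullet> w) = t * ((v - m) \<bullet> w)" by (metis inner_scaleR_left)
  moreover have "s * ((u - m) \<bullet> w) \<le> 0" using s assms by (simp add: mult_nonneg_nonpos)
  ultimately have "t * ((v - m) \<bullet> w) \<le> 0" by simp
  then have "t = 0" using t assms(2) by (simp add: mult_le_0_iff)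
  then show "z \<in> {m}" using t by simp
qed

text \<open>Along the segment the squared distance from \<open>c\<close> is the squared radius plus
  a nonnegative linear term plus \<open>(t * norm (v - u))\<^sup>2\<close>, so it exceeds the
  squared radius away from \<open>u\<close>.\<close>

lemma segment_leaves_cball:
  fixes u :: "'a::real_inner"
  assumes "dist c u = r" "(v - u) \<bullet> (u - c) \<ge> 0"
  shows "closed_segment u v \<inter> cball c r = {u}"
proof (intro equalityI subsetI)
  fix z assume z: "z \<in> closed_segment u v \<inter> cball c r"
  then obtain t where t: "0 \<le> t" "z = u + t *\<^sub>R (v - u)" by (auto simp: in_segment algebra_simps)
  have "(norm (z - c))\<^sup>2 = (norm ((u - c) + t *\<^sub>R (v - u)))\<^sup>2"
    unfolding t(2) diff_add_eq ..
  also have "\<dots> = (norm (u - c))\<^sup>2 + 2 * t * ((v - u) \<bullet> (u - c)) + (t * norm (v - u))\<^sup>2"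
    unfolding power_mult_distrib power2_norm_eq_inner
    by (simp add: inner_add_left inner_add_right inner_commute power2_eq_square)
  finally have "(norm (z - c))\<^sup>2 \<ge> (norm (u - c))\<^sup>2 + (t * norm (v - u))\<^sup>2"
    using t(1) assms(2) by simp
  moreover have "(norm (z - c))\<^sup>2 \<le> (norm (u - c))\<^sup>2"
    using z assms(1) by (intro power_mono) (auto simp: dist_norm norm_minus_commute)
  ultimately have "(t * norm (v - u))\<^sup>2 \<le> 0" by linarith
  then have "t *\<^sub>R (v - u) = 0" by simp
  then show "z \<in> {u}" using t by simp
qed (use assms in auto)

lemma embedded_diagram:
  assumes "finite (edges D)" "\<And>e. e \<in> edges D \<Longrightarrow> card e = 2"
    and "pairwise (\<lambda>e e'. convex hull e \<inter> convex hull e' \<subseteq> e \<inter> e') (edges D)"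
  shows "regular_diagram D" "crossings D = {}"
proof -
  show cr: "crossings D = {}"
    using assms(3) unfolding crossings_def pairwise_def by blast
  have "x \<in> e \<longleftrightarrow> x \<in> e'" if "e \<in> edges D" "e' \<in> edges D" "x \<in> convex hull e \<inter> convex hull e'" for e e' x
    using that assms(3) unfolding pairwise_def by (cases "e = e'") blast+
  then show "regular_diagram D" unfolding regular_diagram_def cr using assms(1,2) by blast
qed

lemma corner_simps [simp]:
  "Re NW = -1" "Im NW = 1" "Re NE = 1" "Im NE = 1" "Re SW = -1" "Im SW = -1" "Re SE = 1" "Im SE = -1"
  "NW \<noteq> NE" "NW \<noteq> SW" "NW \<noteq> SE" "NE \<noteq> NW" "NE \<noteq> SW" "NE \<noteq> SE"
  "SW \<noteq> NW" "SW \<noteq> NE" "SW \<noteq> SE" "SE \<noteq> NW" "SE \<noteq> NE" "SE \<noteq> SW"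
  by (simp_all add: NW_def NE_def SW_def SE_def)

lemma norm_corner: "v \<in> {NW, NE, SW, SE} \<Longrightarrow> norm v = sqrt 2"
  by (auto simp: norm_complex_def)

lemma curve_in_disc:
  assumes "ball_tangle_diagram B"
  shows "curve B \<subseteq> cball 0 (sqrt 2)"
proof -
  have *: "norm v \<le> sqrt 2" if "v \<in> \<Union>(edges B)" for v
    using assms that norm_corner[of v] unfolding ball_tangle_diagram_def by (metis less_imp_le order_refl)
  have "e \<subseteq> cball 0 (sqrt 2)" if "e \<in> edges B" for e using that * by fastforce
  then have "convex hull e \<subseteq> cball 0 (sqrt 2)" if "e \<in> edges B" for e
    using that by (intro hull_minimal) auto
  then show ?thesis by (auto simp: curve_def)
qed

lemma ball_tangle_regular: "ball_tangle_diagram B \<Longrightarrow> regular_diagram B"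
  by (simp add: ball_tangle_diagram_def)

text \<open>Corners are vertices, and regularity forbids a vertex in the interior of an
  edge.\<close>

lemma corner_in_edge:
  assumes "ball_tangle_diagram B" "e \<in> edges B" "v \<in> convex hull e" "v \<in> {NW, NE, SW, SE}"
  shows "v \<in> e"
  using assms(1,4) by (intro regular_vertex[OF ball_tangle_regular[OF assms(1)] assms(2,3)])
    (auto simp: ball_tangle_diagram_def)

section \<open>Types of states and the brackets of the closures\<close>

definition state_type :: "diagram \<Rightarrow> complex set \<Rightarrow> bool \<Rightarrow> nat \<Rightarrow> bool" where
  "state_type B \<sigma> h k \<longleftrightarrow> (\<forall>\<^sub>F \<epsilon> in at_right 0.
     two_arcs k (split_diagram B \<sigma> \<epsilon>) NW (if h then NE else SW) (if h then SW else NE) SE)"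

text \<open>\<open>h\<close> stands for horizontal arcs and \<open>k\<close> counts the further
  circles. The filter is proper, so two eventual facts hold together for some
  \<open>\<epsilon>\<close>, and there the set determines its components.\<close>

lemma state_type_unique:
  assumes "state_type B \<sigma> h k" "state_type B \<sigma> h' k'"
  shows "h = h'" "k = k'"
proof -
  have "\<forall>\<^sub>F \<epsilon> in at_right (0::real). h = h' \<and> k = k'"
    using assms unfolding state_type_def
  proof eventually_elim
    case (elim \<epsilon>)
    then have "h = h'" by (cases h; cases h') (auto dest: two_arcs_exclusive)
    moreover have "k = k'" using elim[THEN two_arcs_card_components] by simp
    ultimately show ?case ..
  qed
  then show "h = h'" "k = k'" by (simp_all add: eventually_const_iff)
qed

lemma num_circles_eqI:
  assumes "\<forall>\<^sub>F \<epsilon> in at_right 0. card (components (split_diagram D \<sigma> \<epsilon>)) = n"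
  shows "num_circles D \<sigma> = n"
  unfolding num_circles_def
proof (rule the_equality[where a = n])
  fix m assume "\<forall>\<^sub>F \<epsilon> in at_right 0. card (components (split_diagram D \<sigma> \<epsilon>)) = m"
  with assms have "\<forall>\<^sub>F \<epsilon> in at_right (0::real). m = n" by eventually_elim simp
  then show "m = n" by (simp add: eventually_const_iff)
qed (fact assms)

definition weight :: "diagram \<Rightarrow> complex set \<Rightarrow> complex" where
  "weight D \<sigma> = exp (\<i> * of_real pi / 4) powi (int (card \<sigma>) - int (card (crossings D - \<sigma>)))"

text \<open>Only \<open>k = 0\<close> matters: a further circle persists in either closure and
  excludes d(\<sigma>) = 1.\<close>

definition type_sum :: "diagram \<Rightarrow> bool \<Rightarrow> complex" where
  "type_sum B h = (\<Sum>\<sigma> | \<sigma> \<subseteq> crossings B \<and> state_type B \<sigma> h 0. weight B \<sigma>)"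

text \<open>Every state must have a type, since a state without one might still contribute to the
  bracket of a closure.\<close>

definition typed_tangle :: "diagram \<Rightarrow> bool" where
  "typed_tangle B \<longleftrightarrow> ball_tangle_diagram B \<and> finite (crossings B) \<and>
     (\<forall>\<sigma>\<subseteq>crossings B. \<exists>h k. state_type B \<sigma> h k)"

text \<open>The closing arcs enter only through their contact with the disc, so both closures can be
  treated at once.\<close>

locale cap =
  fixes B E :: diagram and L M :: "complex set" and a b c d :: complex
  assumes B: "typed_tangle B"
    and capE: "regular_diagram E" "crossings E = {}" "curve E = L \<union> M"
    and L: "compact L" "connected L" "L \<inter> cball 0 (sqrt 2) = {a, b}"
    and M: "compact M" "connected M" "M \<inter> cball 0 (sqrt 2) = {c, d}"
    and LM: "L \<inter> M = {}"
    and corners: "{a, b, c, d} \<subseteq> {NW, NE, SW, SE}"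
    and caps: "\<And>e. e \<in> edges E \<Longrightarrow> convex hull e \<inter> cball 0 (sqrt 2) \<subseteq> e \<inter> {NW, NE, SW, SE}"
begin

lemma tangle: "ball_tangle_diagram B" and finite_crossings: "finite (crossings B)"
  using B by (auto simp: typed_tangle_def)

sublocale gluing B E
proof
  show "compatible B E"
    unfolding compatible_def
  proof (intro ballI subsetI)
    fix e e' x assume e: "e \<in> edges B" "e' \<in> edges E" and x: "x \<in> convex hull e \<inter> convex hull e'"
    have "x \<in> cball 0 (sqrt 2)" using curve_in_disc[OF tangle] e x by (auto simp: curve_def)
    then have "x \<in> e' \<inter> {NW, NE, SW, SE}" using caps[OF e(2)] x by blast
    then show "x \<in> e \<inter> e'" using corner_in_edge[OF tangle e(1)] x by blast
  qed
qed (use tangle capE in \<open>auto simp: ball_tangle_regular\<close>)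

text \<open>The split tangle stays inside the disc, hence meets the caps in corners only. The count
  is supplied through the premise \<open>n\<close>, so that closing parallel and closing across
  share the argument.\<close>

lemma closure_components:
  assumes "\<forall>\<^sub>F \<epsilon> in at_right 0. two_arcs k (split_diagram B \<sigma> \<epsilon>) NW y z SE"
    and "{y, z} = {NE, SW}"
    and n: "\<And>S. two_arcs k S NW y z SE \<Longrightarrow> L \<inter> S = {a, b} \<Longrightarrow> M \<inter> S = {c, d} \<Longrightarrow>
      card (components (S \<union> (L \<union> M))) = n"
  shows "num_circles (glue B E) \<sigma> = n"
proof (rule num_circles_eqI)
  have "\<forall>\<^sub>F \<epsilon> in at_right 0. split_diagram (glue B E) \<sigma> \<epsilon> = split_diagram B \<sigma> \<epsilon> \<union> split_diagram E \<sigma> \<epsilon>"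
    using finite_crossings capE by (intro eventually_split_glue) auto
  with assms(1) show "\<forall>\<^sub>F \<epsilon> in at_right 0. card (components (split_diagram (glue B E) \<sigma> \<epsilon>)) = n"
  proof eventually_elim
    case (elim \<epsilon>)
    let ?S = "split_diagram B \<sigma> \<epsilon>"
    have S: "?S \<subseteq> cball 0 (sqrt 2)"
      using split_diagram_subset[OF D curve_in_disc[OF tangle]] by simp
    have "{NW, NE, SW, SE} \<subseteq> ?S" using two_arcs_mem[OF elim(1)] assms(2) by auto
    then have "L \<inter> ?S = {a, b}" "M \<inter> ?S = {c, d}" using S L(3) M(3) corners by blast+
    then show ?case using n[OF elim(1)] elim(2) capE by (simp add: split_diagram_no_crossings)
  qed
qed

text \<open>\<open>k + 2\<close> is never 1, and \<open>k + 1\<close> is 1 only for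
  \<open>k = 0\<close>; exactly the circle-free states of type \<open>h0\<close> survive.\<close>

lemma bracket_closure:
  assumes "\<And>\<sigma> h k. state_type B \<sigma> h k \<Longrightarrow> num_circles (glue B E) \<sigma> = (if h = h0 then k + 1 else k + 2)"
  shows "bracket (glue B E) = type_sum B h0"
proof -
  have "num_circles (glue B E) \<sigma> = 1 \<longleftrightarrow> state_type B \<sigma> h0 0" if \<sigma>: "\<sigma> \<subseteq> crossings B" for \<sigma>
  proof -
    obtain h k where hk: "state_type B \<sigma> h k" using B \<sigma> by (auto simp: typed_tangle_def)
    then have "num_circles (glue B E) \<sigma> = 1 \<longleftrightarrow> h = h0 \<and> k = 0" using assms by simp
    then show ?thesis using hk state_type_unique[OF hk, of h0 0] by auto
  qed
  then have "{\<sigma>. \<sigma> \<subseteq> crossings B \<and> num_circles (glue B E) \<sigma> = 1} =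
      {\<sigma>. \<sigma> \<subseteq> crossings B \<and> state_type B \<sigma> h0 0}" by blast
  then show ?thesis
    unfolding bracket_def type_sum_def weight_def crossings_glue capE(2) by simp
qed

end

lemma compact_bend: "compact (closed_segment u m \<union> closed_segment m (v::complex))"
  by (intro compact_Un compact_segment)

lemma connected_bend: "connected (closed_segment u m \<union> closed_segment m (v::complex))"
  by (rule connected_Un) auto

lemma cmod_corner [simp]: "cmod NW = sqrt 2" "cmod NE = sqrt 2" "cmod SW = sqrt 2" "cmod SE = sqrt 2"
  by (simp_all add: norm_corner)

lemma pairwise_four:
  assumes "\<And>x y. R x y \<Longrightarrow> R y x" "R a b" "R a c" "R a d" "R b c" "R b d" "R c d"
  shows "pairwise R {a, b, c, d}"
  using assms by (auto simp: pairwise_def)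

text \<open>The corner \<open>b\<close> is joined to \<open>NW\<close> through the bend
  \<open>m\<close>, and \<open>c\<close> to \<open>SE\<close> through \<open>m'\<close>. Both caps
  advance in direction \<open>w\<close>, a line through the origin with normal \<open>u\<close>
  separates them, and \<open>out\<close> makes their edges leave the disc.\<close>

lemma bracket_glue_caps:
  fixes m m' w u :: complex and h :: bool
  defines "b \<equiv> (if h then SW else NE)" and "c \<equiv> (if h then NE else SW)"
  assumes B: "typed_tangle B"
    and E: "E = \<lparr>edges = {{NW, m}, {m, b}, {c, m'}, {m', SE}}, over = over B\<rparr>"
    and w: "(NW - m) \<bullet> w < 0" "(b - m) \<bullet> w > 0" "(c - m') \<bullet> w < 0" "(SE - m') \<bullet> w > 0"
    and u: "\<forall>x\<in>{NW, m, b}. u \<bullet> x > 0" "\<forall>x\<in>{c, m', SE}. u \<bullet> x < 0"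
    and out: "(m - NW) \<bullet> NW \<ge> 0" "(m - b) \<bullet> b \<ge> 0" "(m' - c) \<bullet> c \<ge> 0" "(m' - SE) \<bullet> SE \<ge> 0"
  shows "bracket (glue B E) = type_sum B h"
proof -
  define L M where "L = closed_segment NW m \<union> closed_segment m b"
    and "M = closed_segment c m' \<union> closed_segment m' SE"
  have bc: "dist 0 b = sqrt 2" "dist 0 c = sqrt 2" "{b, c} = {NE, SW}" by (auto simp: b_def c_def)
  have "L \<subseteq> {x. u \<bullet> x > 0}"
    unfolding L_def using u by (intro Un_least closed_segment_subset convex_halfspace_gt) auto
  moreover have "M \<subseteq> {x. u \<bullet> x < 0}"
    unfolding M_def using u by (intro Un_least closed_segment_subset convex_halfspace_lt) auto
  ultimately have LM: "L \<inter> M = {}" by force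
  then have sep: "closed_segment NW m \<inter> closed_segment c m' = {}" "closed_segment NW m \<inter> closed_segment m' SE = {}"
    "closed_segment m b \<inter> closed_segment c m' = {}" "closed_segment m b \<inter> closed_segment m' SE = {}"
    unfolding L_def M_def by blast+
  have bend: "closed_segment NW m \<inter> closed_segment m b \<subseteq> {m}"
    "closed_segment c m' \<inter> closed_segment m' SE \<subseteq> {m'}"
    using w by (auto dest: segments_meet_at_endpoint)
  have disc: "closed_segment NW m \<inter> cball 0 (sqrt 2) = {NW}" "closed_segment m b \<inter> cball 0 (sqrt 2) = {b}"
    "closed_segment c m' \<inter> cball 0 (sqrt 2) = {c}" "closed_segment m' SE \<inter> cball 0 (sqrt 2) = {SE}"
    unfolding closed_segment_commute[of m] closed_segment_commute[of m' SE]
    using out bc by (auto intro!: segment_leaves_cball)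
  have hulls: "convex hull {x, y} = closed_segment x y" for x y :: complex
    by (simp add: segment_convex_hull)
  have pw: "pairwise (\<lambda>e e'. convex hull e \<inter> convex hull e' \<subseteq> e \<inter> e') (edges E)"
    unfolding E diagram.simps
    by (rule pairwise_four[where R = "\<lambda>e e'. convex hull e \<inter> convex hull e' \<subseteq> e \<inter> e'"])
      (use sep bend in \<open>auto simp: hulls\<close>)
  have "NW \<noteq> m" "m \<noteq> b" "c \<noteq> m'" "m' \<noteq> SE" using w by auto
  then have card2: "card e = 2" if "e \<in> edges E" for e using that by (auto simp: E)
  interpret cap B E L M NW b c SE
  proof
    show "regular_diagram E" "crossings E = {}"
      by (rule embedded_diagram[OF _ card2 pw]; simp add: E)+
    show "curve E = L \<union> M" by (simp add: curve_def E L_def M_def hulls Un_assoc)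
    show "L \<inter> cball 0 (sqrt 2) = {NW, b}" "M \<inter> cball 0 (sqrt 2) = {c, SE}"
      unfolding L_def M_def Int_Un_distrib2 disc by auto
    show "convex hull e \<inter> cball 0 (sqrt 2) \<subseteq> e \<inter> {NW, NE, SW, SE}" if "e \<in> edges E" for e
    proof -
      have "e = {NW, m} \<or> e = {m, b} \<or> e = {c, m'} \<or> e = {m', SE}" using that by (simp add: E)
      moreover have "b \<in> {NW, NE, SW, SE}" "c \<in> {NW, NE, SW, SE}" by (simp_all add: b_def c_def)
      ultimately show ?thesis using disc by (elim disjE) (simp_all add: hulls)
    qed
  qed (use B LM bc(3) in \<open>auto simp: L_def M_def compact_bend connected_bend\<close>)
  show ?thesis
  proof (rule bracket_closure)
    fix \<sigma> h' k assume st: "state_type B \<sigma> h' k"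
    show "num_circles (glue B E) \<sigma> = (if h' = h then k + 1 else k + 2)"
    proof (cases "h' = h")
      case True
      \<comment> \<open>Now each cap runs from one arc of the state to the other.\<close>
      have st': "\<forall>\<^sub>F \<epsilon> in at_right 0. two_arcs k (split_diagram B \<sigma> \<epsilon>) NW c b SE"
        using st True unfolding state_type_def b_def c_def by simp
      have "num_circles (glue B E) \<sigma> = k + 1"
        by (rule closure_components[OF st'])
          (use bc(3) two_arcs_close_across[OF _ L(1,2) _ M(1,2) _ LM] in auto)
      then show ?thesis using True by simp
    next
      case False
      \<comment> \<open>Now each cap joins the two ends of one and the same arc.\<close>
      have st': "\<forall>\<^sub>F \<epsilon> in at_right 0. two_arcs k (split_diagram B \<sigma> \<epsilon>) NW b c SE"
        using st False unfolding state_type_def b_def c_def by (cases h) simp_all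
      have "num_circles (glue B E) \<sigma> = k + 2"
        by (rule closure_components[OF st'])
          (use bc(3) two_arcs_close_parallel[OF _ L(1,2) _ M(1,2) _ LM] in auto)
      then show ?thesis using False by simp
    qed
  qed
qed

lemma glue_same_over: "glue B \<lparr>edges = Es, over = over B\<rparr> = B\<lparr>edges := edges B \<union> Es\<rparr>"
  by (cases B) (simp add: glue_def fun_eq_iff)

lemma bracket_numerator_closure:
  assumes "typed_tangle B"
  shows "bracket (numerator_closure B) = type_sum B False"
proof -
  let ?E = "\<lparr>edges = {{NW, Complex 0 3}, {Complex 0 3, NE}, {SW, Complex 0 (-3)}, {Complex 0 (-3), SE}},
    over = over B\<rparr>"
  have "bracket (glue B ?E) = type_sum B False"
    \<comment> \<open>The caps run from left to right, and the real axis with normal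
      \<open>\<i>\<close> separates them.\<close>
    by (rule bracket_glue_caps[OF assms, of _ "Complex 0 3" False "Complex 0 (-3)" 1 \<i>])
      (simp_all add: inner_complex_def)
  then show ?thesis by (simp add: glue_same_over numerator_closure_def)
qed

lemma bracket_denominator_closure:
  assumes "typed_tangle B"
  shows "bracket (denominator_closure B) = type_sum B True"
proof -
  let ?E = "\<lparr>edges = {{NW, Complex (-3) 0}, {Complex (-3) 0, SW}, {NE, Complex 3 0}, {Complex 3 0, SE}},
    over = over B\<rparr>"
  have "bracket (glue B ?E) = type_sum B True"
    \<comment> \<open>The caps run downwards, and the imaginary axis with normal -1 separates
      them.\<close>
    by (rule bracket_glue_caps[OF assms, of _ "Complex (-3) 0" True "Complex 3 0" "-\<i>" "-1"])
      (simp_all add: inner_complex_def)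
  then show ?thesis by (simp add: glue_same_over denominator_closure_def)
qed

text \<open>One phase serves both entries, which fixes their relative sign. With an actual pair
  instead of its class, rotation and sum act by formulas on integers.\<close>

definition realizes :: "diagram \<Rightarrow> int \<Rightarrow> int \<Rightarrow> bool" where
  "realizes B p q \<longleftrightarrow> typed_tangle B \<and>
     (\<exists>z. z ^ 8 = 1 \<and> z * type_sum B False = of_int p \<and> \<i> * z * type_sum B True = of_int q)"

text \<open>\<open>u\<close> is a quotient of integers, hence real, and it has modulus 1.\<close>

lemma real_root_of_unity:
  assumes "u ^ 8 = 1" "u * of_int p \<in> \<int>" "p \<noteq> 0"
  shows "u = 1 \<or> u = (-1::complex)"
proof -
  obtain m where m: "u * of_int p = of_int m" using assms(2) by (auto elim: Ints_cases)
  define r :: real where "r = of_int m / of_int p"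
  have u: "u = of_real r" using m assms(3) by (simp add: r_def field_simps)
  have "cmod u ^ 8 = 1" using assms(1) by (metis norm_one norm_power)
  then have "\<bar>r\<bar> = 1" using power_eq_imp_eq_base[of "\<bar>r\<bar>" 8 1] by (simp add: u)
  then show ?thesis using u by (auto simp: abs_if split: if_splits)
qed

text \<open>Every other phase is \<open>u * z\<close> with \<open>u\<close> an eighth root of unity;
  integrality of a nonzero entry leaves \<open>u = 1\<close> and \<open>u = -1\<close>, which yield
  the two members of the class.\<close>

lemma realizes_invariant:
  assumes "realizes B p q"
  shows "ball_tangle_diagram B" "ball_tangle_invariant B = pm_class p q"
proof -
  have B: "typed_tangle B" using assms by (simp add: realizes_def)
  then show "ball_tangle_diagram B" by (simp add: typed_tangle_def)
  obtain z where z: "z ^ 8 = 1" "z * type_sum B False = of_int p" "\<i> * z * type_sum B True = of_int q"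
    using assms by (auto simp: realizes_def)
  have z0: "z \<noteq> 0" using z(1) by auto
  let ?v = "\<lambda>y. vector [y * type_sum B False, \<i> * y * type_sum B True] :: complex ^ 2"
  have v: "?v (u * z) = vector [u * of_int p, u * of_int q]" for u
  proof -
    have "u * z * type_sum B False = u * (z * type_sum B False)"
      "\<i> * (u * z) * type_sum B True = u * (\<i> * z * type_sum B True)" by simp_all
    then show ?thesis by (simp only: z(2,3))
  qed
  have all2: "(\<forall>j. (vector [x, y] :: complex ^ 2) $ j \<in> \<int>) \<longleftrightarrow> x \<in> \<int> \<and> y \<in> \<int>" for x y :: complex
    by (simp add: forall_2)
  have neg: "- vector [x, y] = (vector [- x, - y] :: complex ^ 2)" for x y :: complex
    by (simp add: vec_eq_iff forall_2)
  have inv: "ball_tangle_invariant B = {?v y | y. y ^ 8 = 1} \<inter> {v. \<forall>j. v $ j \<in> \<int>}"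
    unfolding ball_tangle_invariant_def bracket_numerator_closure[OF B] bracket_denominator_closure[OF B] ..
  show "ball_tangle_invariant B = pm_class p q"
    unfolding inv
  proof (intro equalityI subsetI)
    fix x assume "x \<in> {?v y | y. y ^ 8 = 1} \<inter> {v. \<forall>j. v $ j \<in> \<int>}"
    then obtain y where y: "y ^ 8 = 1" "x = ?v y" "\<forall>j. x $ j \<in> \<int>" by blast
    define u where "u = y / z"
    have u: "u ^ 8 = 1" "y = u * z" using y(1) z(1) z0 by (simp_all add: u_def power_divide)
    have x: "x = vector [u * of_int p, u * of_int q]" unfolding y(2) u(2) by (rule v)
    then have int: "u * of_int p \<in> \<int>" "u * of_int q \<in> \<int>" using y(3) all2 by auto
    show "x \<in> pm_class p q"
    proof (cases "p = 0 \<and> q = 0")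
      \<comment> \<open>All eight phases give the zero vector, which is the only member of the
        class.\<close>
      case True
      then show ?thesis using x by (simp add: pm_class_def)
    next
      case False
      then have "u = 1 \<or> u = -1" using real_root_of_unity[OF u(1)] int by blast
      then show ?thesis using x by (auto simp: pm_class_def neg)
    qed
  next
    fix x assume "x \<in> pm_class p q"
    then have "x = vector [1 * of_int p, 1 * of_int q] \<or> x = vector [-1 * of_int p, -1 * of_int q]"
      by (auto simp: pm_class_def neg)
    then obtain u :: complex where u: "u = 1 \<or> u = -1" "x = vector [u * of_int p, u * of_int q]" by blast
    then have "x = ?v (u * z)" "(u * z) ^ 8 = 1" using v z(1) by (auto simp: power_mult_distrib)
    moreover have "\<forall>j. x $ j \<in> \<int>" using u all2 by auto
    ultimately show "x \<in> {?v y | y. y ^ 8 = 1} \<inter> {v. \<forall>j. v $ j \<in> \<int>}" by blast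
  qed
qed

section \<open>Rotation and the trivial tangle\<close>

lemma (in similarity) weight_transform:
  assumes "\<sigma> \<subseteq> crossings D"
  shows "weight (transform D) (f ` \<sigma>) = weight D \<sigma>"
proof -
  have "crossings (transform D) - f ` \<sigma> = f ` (crossings D - \<sigma>)"
    using inj_f by (simp add: crossings_transform image_set_diff)
  then show ?thesis by (simp add: weight_def)
qed

lemma (in similarity) vertices_transform: "\<Union>(edges (transform D)) = f ` \<Union>(edges D)"
  by auto

definition corners :: "complex set" where
  "corners = {NW, NE, SW, SE}"

text \<open>Valency is additive under gluing and invariant under similarities, which makes this form
  easy to check for the constructed diagrams.\<close>

lemma ball_tangle_iff:
  "ball_tangle_diagram B \<longleftrightarrow> regular_diagram B \<and> corners \<subseteq> \<Union>(edges B) \<and>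
     (\<forall>v\<in>\<Union>(edges B). (v \<in> corners \<longrightarrow> valency B v = 1) \<and>
        (v \<notin> corners \<longrightarrow> norm v < sqrt 2 \<and> valency B v = 2))"
  unfolding ball_tangle_diagram_def corners_def valency_def if_bool_eq_conj by (rule refl)

lemma valency_disjoint:
  assumes "disjoint (edges D)" "v \<in> \<Union>(edges D)"
  shows "valency D v = 1"
proof -
  obtain e where e: "e \<in> edges D" "v \<in> e" using assms(2) by blast
  then have "{e \<in> edges D. v \<in> e} = {e}" using assms(1) by (auto simp: disjoint_def)
  then show ?thesis by (simp add: valency_def)
qed

definition rotate :: "diagram \<Rightarrow> diagram" where
  "rotate = similarity.transform \<i> 0"

interpretation rotation: similarity \<i> 0
  rewrites "similarity.transform \<i> 0 = rotate"
  by (unfold_locales) (simp_all add: rotate_def)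

lemma rotation_corners [simp]:
  "rotation.f NW = SW" "rotation.f SW = SE" "rotation.f SE = NE" "rotation.f NE = NW"
  by (simp_all add: rotation.f_def complex_eq_iff)

lemma ball_tangle_rotate:
  assumes "ball_tangle_diagram B"
  shows "ball_tangle_diagram (rotate B)"
proof -
  have corners: "corners = rotation.f ` corners" by (auto simp: corners_def)
  have "rotation.f v \<in> corners \<longleftrightarrow> v \<in> corners" for v
    by (subst corners) (rule rotation.f_mem_iff)
  moreover have "norm (rotation.f v) = norm v" for v by (simp add: rotation.f_def norm_mult)
  moreover have "corners \<subseteq> \<Union>(edges (rotate B))"
    unfolding rotation.vertices_transform
    by (subst corners, rule image_mono) (use assms in \<open>simp add: ball_tangle_iff\<close>)
  ultimately show ?thesis
    using assms rotation.regular_transform[of B]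
    unfolding ball_tangle_iff rotation.vertices_transform ball_simps rotation.valency_transform by simp
qed

text \<open>The quarter turn sends \<open>NW\<close> and \<open>NE\<close> to \<open>SW\<close> and
  \<open>NW\<close>, so horizontal arcs become vertical and conversely; swapping and reversing
  restore the standard order of the corners.\<close>

lemma state_type_rotate:
  assumes "state_type B \<sigma> h k"
  shows "state_type (rotate B) (rotation.f ` \<sigma>) (\<not> h) k"
  using rotation.eventually_two_arcs_transform[OF assms[unfolded state_type_def]]
  unfolding state_type_def
  by (rule eventually_mono) (auto split: if_splits intro: two_arcs_swap two_arcs_reverse)

lemma typed_tangle_rotate:
  assumes "typed_tangle B"
  shows "typed_tangle (rotate B)"
proof -
  have "\<exists>h k. state_type (rotate B) \<sigma> h k" if \<sigma>: "\<sigma> \<subseteq> crossings (rotate B)" for \<sigma>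
  proof -
    obtain \<tau> where "\<tau> \<subseteq> crossings B" "\<sigma> = rotation.f ` \<tau>"
      using \<sigma> unfolding rotation.crossings_transform by (auto simp: subset_image_iff)
    then show ?thesis using assms state_type_rotate unfolding typed_tangle_def by blast
  qed
  then show ?thesis
    using assms ball_tangle_rotate by (simp add: typed_tangle_def rotation.crossings_transform)
qed

text \<open>Rotating gives one implication between the types. The converse holds because the state
  has some type before the rotation and types are unique.\<close>

lemma type_sum_rotate:
  assumes B: "typed_tangle B"
  shows "type_sum (rotate B) (\<not> h) = type_sum B h"
proof -
  have iff: "state_type (rotate B) (rotation.f ` \<tau>) (\<not> h) 0 \<longleftrightarrow> state_type B \<tau> h 0"
    if \<tau>: "\<tau> \<subseteq> crossings B" for \<tau>
  proof
    assume l: "state_type (rotate B) (rotation.f ` \<tau>) (\<not> h) 0"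
    obtain h' k' where "state_type B \<tau> h' k'" using B \<tau> by (auto simp: typed_tangle_def)
    then show "state_type B \<tau> h 0" using state_type_unique[OF l state_type_rotate, of h' k'] by simp
  qed (rule state_type_rotate)
  have "{\<sigma>. \<sigma> \<subseteq> crossings (rotate B) \<and> state_type (rotate B) \<sigma> (\<not> h) 0} =
      (`) rotation.f ` {\<tau>. \<tau> \<subseteq> crossings B \<and> state_type B \<tau> h 0}"
    unfolding rotation.crossings_transform using iff by (fastforce simp: subset_image_iff)
  moreover have "inj_on ((`) rotation.f) X" for X by (simp add: inj_on_def)
  ultimately show ?thesis
    unfolding type_sum_def by (simp add: sum.reindex rotation.weight_transform)
qed

lemma realizes_rotate:
  assumes "realizes B p q"
  shows "realizes (rotate B) q (- p)"
proof -
  have B: "typed_tangle B" using assms by (simp add: realizes_def)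
  obtain z where z: "z ^ 8 = 1" "z * type_sum B False = of_int p" "\<i> * z * type_sum B True = of_int q"
    using assms by (auto simp: realizes_def)
  have "type_sum (rotate B) False = type_sum B True" "type_sum (rotate B) True = type_sum B False"
    using type_sum_rotate[OF B, of True] type_sum_rotate[OF B, of False] by simp_all
  \<comment> \<open>With phase \<open>\<i> * z\<close> the old second entry becomes the first; the
    second entry carries one more factor \<open>\<i>\<close>, and the square of \<open>\<i>\<close>
    produces the sign in \<open>- p\<close>.\<close>
  moreover have "(\<i> * z) ^ 8 = 1" using z(1) by (simp add: power_mult_distrib)
  moreover have "\<i> * (\<i> * z) * x = - (z * x)" for x
    by (simp add: mult.assoc[symmetric])
  ultimately show ?thesis
    using z typed_tangle_rotate[OF B] unfolding realizes_def by (intro conjI exI[of _ "\<i> * z"]) simp_all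
qed

section \<open>The tangle with two horizontal arcs\<close>

definition zero_tangle :: diagram where
  "zero_tangle = \<lparr>edges = {{NW, NE}, {SW, SE}}, over = (\<lambda>_. {})\<rparr>"

lemma realizes_zero_tangle: "realizes zero_tangle 0 1"
proof -
  let ?L = "closed_segment NW NE" and ?M = "closed_segment SW SE"
  have hulls: "convex hull {x, y} = closed_segment x y" for x y :: complex
    by (simp add: segment_convex_hull)
  have LM: "?L \<inter> ?M = {}" by (auto dest!: segment_box)
  have reg: "regular_diagram zero_tangle" "crossings zero_tangle = {}"
    by (rule embedded_diagram; use LM in \<open>auto simp: zero_tangle_def pairwise_insert hulls\<close>)+
  have "disjoint (edges zero_tangle)" by (simp add: zero_tangle_def disjoint_def insert_commute)
  moreover have V: "\<Union>(edges zero_tangle) = corners" by (auto simp: zero_tangle_def corners_def)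
  ultimately have tangle: "ball_tangle_diagram zero_tangle"
    unfolding ball_tangle_iff using reg(1) by (simp add: valency_disjoint)
  have "?L \<noteq> ?M" using LM ends_in_segment(1)[of NW NE] by blast
  have "parts [?L, ?M] (?L \<union> ?M)"
    using LM \<open>?L \<noteq> ?M\<close> by (simp add: parts_def disjoint_def Int_commute)
  then have "two_arcs 0 (?L \<union> ?M) NW NE SW SE" by (rule two_arcsI) auto
  moreover have "split_diagram zero_tangle \<sigma> \<epsilon> = ?L \<union> ?M" for \<sigma> \<epsilon>
    unfolding split_diagram_no_crossings[OF reg(2)] by (simp add: curve_def zero_tangle_def hulls)
  ultimately have st: "state_type zero_tangle {} True 0" by (simp add: state_type_def)
  then have typed: "typed_tangle zero_tangle" using tangle reg by (auto simp: typed_tangle_def)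
  have no: "\<not> state_type zero_tangle {} False 0" using state_type_unique(1)[OF st] by blast
  have eq: "{\<sigma>. \<sigma> = {} \<and> P \<sigma>} = (if P {} then {{}} else {})" for P :: "complex set \<Rightarrow> bool" by auto
  have "type_sum zero_tangle True = 1" "type_sum zero_tangle False = 0"
    by (simp_all add: type_sum_def reg weight_def eq st no)
  \<comment> \<open>The only state has weight 1, so the phase must cancel the factor
    \<open>\<i>\<close> of the second entry.\<close>
  moreover have "(- \<i>) ^ 8 = 1" by simp
  ultimately show ?thesis using typed unfolding realizes_def by (intro conjI exI[of _ "- \<i>"]) auto
qed

section \<open>The tangle with one crossing\<close>

lemma closed_segment_scaleR:
  fixes u :: "'a::euclidean_space"
  assumes "a \<le> b"
  shows "closed_segment (a *\<^sub>R u) (b *\<^sub>R u) = (\<lambda>r. r *\<^sub>R u) ` {a..b}"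
proof -
  have "linear (\<lambda>r. r *\<^sub>R u)" by (rule linear_scaleR_left)
  from closed_segment_linear_image[OF this, of a b] show ?thesis
    using assms by (simp add: closed_segment_eq_real_ivl)
qed

lemma SE_eq: "SE = - NW" and SW_eq: "SW = - NE"
  by (simp_all add: complex_eq_iff)

lemma diagonal: "closed_segment u (- u) = (\<lambda>r. r *\<^sub>R u) ` {-1..1}" for u :: complex
  using closed_segment_scaleR[of "-1" 1 u] by (simp add: closed_segment_commute)

text \<open>Corners have norm sqrt 2, so \<open>r *\<^sub>R u\<close> lies in the removed ball
  exactly when the absolute value of \<open>r\<close> is below \<open>\<delta>\<close>.\<close>

lemma diagonal_minus_ball:
  assumes u: "norm u = sqrt 2" and \<epsilon>: "0 < \<epsilon>" "\<epsilon> < sqrt 2"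
  defines "\<delta> \<equiv> \<epsilon> / sqrt 2"
  shows "closed_segment u (- u) - ball 0 \<epsilon> =
    closed_segment u (\<delta> *\<^sub>R u) \<union> closed_segment (\<delta> *\<^sub>R - u) (- u :: complex)"
proof -
  have \<delta>: "0 < \<delta>" "\<delta> < 1" using \<epsilon> by (simp_all add: \<delta>_def)
  have "norm (r *\<^sub>R u) < \<epsilon> \<longleftrightarrow> \<bar>r\<bar> < \<delta>" for r
    using u by (simp add: \<delta>_def field_simps)
  then have "closed_segment u (- u) - ball 0 \<epsilon> = (\<lambda>r. r *\<^sub>R u) ` {r \<in> {-1..1}. \<not> \<bar>r\<bar> < \<delta>}"
    unfolding diagonal by auto
  also have "{r \<in> {-1..1}. \<not> \<bar>r\<bar> < \<delta>} = {\<delta>..1} \<union> {-1..-\<delta>}" using \<delta> by auto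
  also have "(\<lambda>r. r *\<^sub>R u) ` \<dots> = closed_segment (\<delta> *\<^sub>R u) (1 *\<^sub>R u) \<union> closed_segment ((-1) *\<^sub>R u) ((-\<delta>) *\<^sub>R u)"
    using \<delta> by (simp only: image_Un closed_segment_scaleR less_imp_le neg_le_iff_le)
  finally show ?thesis by (simp add: closed_segment_commute)
qed

lemma diagonal_sphere:
  assumes u: "norm u = sqrt 2" and \<epsilon>: "0 < \<epsilon>" "\<epsilon> < sqrt 2"
  shows "z \<in> closed_segment u (- u) \<and> dist 0 z = \<epsilon> \<longleftrightarrow>
    z = (\<epsilon> / sqrt 2) *\<^sub>R u \<or> z = (\<epsilon> / sqrt 2) *\<^sub>R (- u :: complex)"
proof
  assume "z \<in> closed_segment u (- u) \<and> dist 0 z = \<epsilon>"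
  then obtain r where r: "z = r *\<^sub>R u" "dist 0 z = \<epsilon>" unfolding diagonal by blast
  then have "\<bar>r\<bar> * sqrt 2 = \<epsilon>" using u by simp
  then have "r = \<epsilon> / sqrt 2 \<or> r = - (\<epsilon> / sqrt 2)" by (auto simp: field_simps abs_if split: if_splits)
  then show "z = (\<epsilon> / sqrt 2) *\<^sub>R u \<or> z = (\<epsilon> / sqrt 2) *\<^sub>R (- u)"
    using r(1) by (metis scaleR_minus_left scaleR_minus_right)
next
  have \<delta>: "0 < \<epsilon> / sqrt 2" "\<epsilon> / sqrt 2 < 1" using \<epsilon> by simp_all
  assume "z = (\<epsilon> / sqrt 2) *\<^sub>R u \<or> z = (\<epsilon> / sqrt 2) *\<^sub>R (- u)"
  then have "z = (\<epsilon> / sqrt 2) *\<^sub>R u \<or> z = (- (\<epsilon> / sqrt 2)) *\<^sub>R u" by simp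
  moreover have "\<bar>\<epsilon> / sqrt 2\<bar> = \<epsilon> / sqrt 2" "\<bar>- (\<epsilon> / sqrt 2)\<bar> = \<epsilon> / sqrt 2" using \<epsilon> by simp_all
  ultimately obtain r where r: "z = r *\<^sub>R u" "\<bar>r\<bar> = \<epsilon> / sqrt 2" by blast
  then have "\<bar>r\<bar> < 1" using \<delta>(2) by simp
  then have "r \<in> {-1..1}" by auto
  then have "z \<in> closed_segment u (- u)" using r(1) unfolding diagonal by blast
  then show "z \<in> closed_segment u (- u) \<and> dist 0 z = \<epsilon>" using r u by simp
qed

text \<open>Turned counterclockwise, the over-strand sweeps the regions above and below, so the
  \<open>A\<close>-splitting leaves vertical arcs. The other choice of over-strand would give (1,
  -1).\<close>

definition crossing_tangle :: diagram where
  "crossing_tangle = \<lparr>edges = {{NE, SW}, {NW, SE}}, over = (\<lambda>_. {NE, SW})\<rparr>"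

lemma crossing_tangle_edges [simp]:
  "edges crossing_tangle = {{NE, SW}, {NW, SE}}" "over crossing_tangle c = {NE, SW}"
  by (simp_all add: crossing_tangle_def)

lemma diagonals_ne [simp]: "{NE, SW} \<noteq> {NW, SE}" "{NW, SE} \<noteq> {NE, SW}"
  by (simp_all add: doubleton_eq_iff)

lemma hull_diagonals:
  "convex hull {NE, SW} = closed_segment NE (- NE)" "convex hull {NW, SE} = closed_segment NW (- NW)"
  by (simp_all add: segment_convex_hull SE_eq SW_eq)

lemma diagonals_meet: "closed_segment NE (- NE) \<inter> closed_segment NW (- NW) = {0}"
proof -
  have "r = 0" if "r *\<^sub>R NE = s *\<^sub>R NW" for r s
    using that by (simp add: complex_eq_iff)
  moreover have "0 \<in> closed_segment u (- u)" for u :: complex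
    unfolding diagonal by (rule image_eqI[of _ _ 0]) auto
  ultimately show ?thesis unfolding diagonal by fastforce
qed

lemma zero_not_corner: "0 \<notin> {NE, SW}" "0 \<notin> {NW, SE}"
  by (auto simp: complex_eq_iff)

lemma crossings_crossing_tangle: "crossings crossing_tangle = {0}"
proof -
  have "(A - X) \<inter> (B - Y) = A \<inter> B - X - Y" for A B X Y :: "complex set" by blast
  then have eq: "(closed_segment NE (- NE) - {NE, SW}) \<inter> (closed_segment NW (- NW) - {NW, SE}) = {0}"
    using diagonals_meet zero_not_corner by auto
  have "crossings crossing_tangle = (convex hull {NE, SW} - {NE, SW}) \<inter> (convex hull {NW, SE} - {NW, SE})"
    unfolding crossings_def crossing_tangle_edges by (simp add: Int_def conj_ac disj_comms)
  then show ?thesis unfolding hull_diagonals eq .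
qed

lemma ball_tangle_crossing_tangle: "ball_tangle_diagram crossing_tangle"
proof -
  have vertex: "x \<in> e \<longleftrightarrow> x \<in> e'" if "e \<in> edges crossing_tangle" "e' \<in> edges crossing_tangle"
    "x \<in> convex hull e \<inter> convex hull e'" for e e' x
  proof (cases "e = e'")
    case False
    then have "x \<in> closed_segment NE (- NE) \<inter> closed_segment NW (- NW)"
      using that by (auto simp: hull_diagonals)
    then have "x = 0" using diagonals_meet by blast
    then show ?thesis using that zero_not_corner by auto
  qed simp
  have zero: "0 \<in> convex hull {NE, SW}" "0 \<in> convex hull {NW, SE}"
    unfolding hull_diagonals using diagonals_meet by blast+
  then have at_zero: "{e \<in> edges crossing_tangle. 0 \<in> convex hull e} = {{NE, SW}, {NW, SE}}"
    by auto
  have reg: "regular_diagram crossing_tangle"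
    unfolding regular_diagram_def crossings_crossing_tangle
  proof (intro conjI ballI)
    fix c assume c: "c \<in> {0 :: complex}"
    then show "card {e \<in> edges crossing_tangle. c \<in> convex hull e} = 2" using at_zero by simp
    show "over crossing_tangle c \<in> edges crossing_tangle" by simp
    show "c \<in> convex hull (over crossing_tangle c)" using c zero by simp
  next
    show "finite (edges crossing_tangle)" by simp
    show "card e = 2" if "e \<in> edges crossing_tangle" for e using that by auto
  qed (rule vertex)
  have "disjoint (edges crossing_tangle)"
    by (simp add: disjoint_def)
  moreover have "\<Union>(edges crossing_tangle) = corners"
    by (auto simp: corners_def)
  ultimately show ?thesis
    unfolding ball_tangle_iff using reg by (simp add: valency_disjoint del: crossing_tangle_edges)
qed

text \<open>Each strand meets the circle of radius \<open>\<epsilon>\<close> in two points. Of the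
  four chords between the strands, the orientation test keeps two opposite ones.\<close>

lemma splitting_arcs_crossing_tangle:
  assumes \<epsilon>: "0 < \<epsilon>" "\<epsilon> < sqrt 2"
  defines "\<delta> \<equiv> \<epsilon> / sqrt 2"
  shows "splitting_arcs crossing_tangle \<sigma> \<epsilon> 0 =
    (if 0 \<in> \<sigma> then closed_segment (\<delta> *\<^sub>R NW) (\<delta> *\<^sub>R SW) \<union> closed_segment (\<delta> *\<^sub>R NE) (\<delta> *\<^sub>R SE)
     else closed_segment (\<delta> *\<^sub>R NW) (\<delta> *\<^sub>R NE) \<union> closed_segment (\<delta> *\<^sub>R SW) (\<delta> *\<^sub>R SE))"
proof -
  have \<delta>: "\<delta> > 0" using \<epsilon> by (simp add: \<delta>_def)
  have p: "p \<in> convex hull {NE, SW} \<and> dist 0 p = \<epsilon> \<longleftrightarrow> p = \<delta> *\<^sub>R NE \<or> p = \<delta> *\<^sub>R SW" for p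
    unfolding hull_diagonals using diagonal_sphere[of NE \<epsilon> p] \<epsilon> by (simp add: \<delta>_def SW_eq)
  have "0 \<in> convex hull {NW, SE}" unfolding hull_diagonals using diagonals_meet by blast
  then have "(\<exists>e\<in>edges crossing_tangle. e \<noteq> {NE, SW} \<and> 0 \<in> convex hull e \<and> q \<in> convex hull e) \<longleftrightarrow>
      q \<in> convex hull {NW, SE}" for q
    by auto
  then have q: "(\<exists>e\<in>edges crossing_tangle. e \<noteq> {NE, SW} \<and> 0 \<in> convex hull e \<and> q \<in> convex hull e) \<and>
      dist 0 q = \<epsilon> \<longleftrightarrow> q = \<delta> *\<^sub>R NW \<or> q = \<delta> *\<^sub>R SE" for q
    unfolding hull_diagonals using diagonal_sphere[of NW \<epsilon> q] \<epsilon> by (simp add: \<delta>_def SE_eq)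
  let ?R = "\<lambda>p q. if 0 \<in> \<sigma> then Im (cnj (p - 0) * (q - 0)) < 0 else Im (cnj (p - 0) * (q - 0)) > 0"
  have "splitting_arcs crossing_tangle \<sigma> \<epsilon> 0 = \<Union>{closed_segment p q | p q.
      (p = \<delta> *\<^sub>R NE \<or> p = \<delta> *\<^sub>R SW) \<and> (q = \<delta> *\<^sub>R NW \<or> q = \<delta> *\<^sub>R SE) \<and> ?R p q}"
    unfolding splitting_arcs_def crossing_tangle_edges(2) p[symmetric] q[symmetric] by (simp only: conj_assoc)
  moreover have "?R (\<delta> *\<^sub>R NE) (\<delta> *\<^sub>R NW) \<longleftrightarrow> 0 \<notin> \<sigma>" "?R (\<delta> *\<^sub>R NE) (\<delta> *\<^sub>R SE) \<longleftrightarrow> 0 \<in> \<sigma>"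
    "?R (\<delta> *\<^sub>R SW) (\<delta> *\<^sub>R NW) \<longleftrightarrow> 0 \<in> \<sigma>" "?R (\<delta> *\<^sub>R SW) (\<delta> *\<^sub>R SE) \<longleftrightarrow> 0 \<notin> \<sigma>"
    using \<delta> by simp_all
  moreover have "\<Union>{closed_segment p q | p q. (p = a \<or> p = b) \<and> (q = c \<or> q = d) \<and> P p q} =
      (if P a c then closed_segment a c else {}) \<union> (if P a d then closed_segment a d else {}) \<union>
      (if P b c then closed_segment b c else {}) \<union> (if P b d then closed_segment b d else {})"
    for a b c d :: complex and P by auto
  ultimately have "splitting_arcs crossing_tangle \<sigma> \<epsilon> 0 =
    (if 0 \<in> \<sigma> then closed_segment (\<delta> *\<^sub>R SW) (\<delta> *\<^sub>R NW) \<union> closed_segment (\<delta> *\<^sub>R NE) (\<delta> *\<^sub>R SE)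
     else closed_segment (\<delta> *\<^sub>R NE) (\<delta> *\<^sub>R NW) \<union> closed_segment (\<delta> *\<^sub>R SW) (\<delta> *\<^sub>R SE))"
    by (simp only: if_not_P if_P not_not split: if_split) (simp add: Un_commute)
  then show ?thesis by (simp add: closed_segment_commute Un_commute)
qed

text \<open>One strand after the splitting: inwards along a diagonal, across the chord, outwards
  along the other diagonal.\<close>

definition bent :: "real \<Rightarrow> complex \<Rightarrow> complex \<Rightarrow> complex set" where
  "bent \<delta> u v = closed_segment u (\<delta> *\<^sub>R u) \<union> closed_segment (\<delta> *\<^sub>R u) (\<delta> *\<^sub>R v) \<union> closed_segment (\<delta> *\<^sub>R v) v"

lemma split_crossing_tangle:
  assumes \<epsilon>: "0 < \<epsilon>" "\<epsilon> < sqrt 2"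
  defines "\<delta> \<equiv> \<epsilon> / sqrt 2"
  shows "split_diagram crossing_tangle \<sigma> \<epsilon> =
    (if 0 \<in> \<sigma> then bent \<delta> NW SW \<union> bent \<delta> NE SE else bent \<delta> NW NE \<union> bent \<delta> SW SE)"
proof -
  have "curve crossing_tangle = closed_segment NE (- NE) \<union> closed_segment NW (- NW)"
    by (simp add: curve_def hull_diagonals)
  then have "curve crossing_tangle - ball 0 \<epsilon> = closed_segment NE (\<delta> *\<^sub>R NE) \<union> closed_segment (\<delta> *\<^sub>R SW) SW \<union>
      (closed_segment NW (\<delta> *\<^sub>R NW) \<union> closed_segment (\<delta> *\<^sub>R SE) SE)"
    using diagonal_minus_ball[of NE \<epsilon>] diagonal_minus_ball[of NW \<epsilon>] \<epsilon>
    by (simp add: Un_Diff \<delta>_def SE_eq SW_eq)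
  then show ?thesis
    unfolding split_diagram_def curve_def[symmetric] crossings_crossing_tangle bent_def
    using splitting_arcs_crossing_tangle[OF \<epsilon>]
    by (simp add: \<delta>_def[symmetric] closed_segment_commute Un_ac)
qed

lemma compact_bent: "compact (bent \<delta> u v)"
  unfolding bent_def by (intro compact_Un compact_segment)

lemma connected_bent: "connected (bent \<delta> u v)"
proof -
  have "connected (closed_segment u (\<delta> *\<^sub>R u) \<union> closed_segment (\<delta> *\<^sub>R u) (\<delta> *\<^sub>R v))"
    by (rule connected_Un) auto
  then show ?thesis unfolding bent_def by (rule connected_Un) auto
qed

lemma bent_positive:
  assumes "w \<bullet> u > 0" "w \<bullet> v > 0" "\<delta> > 0"
  shows "bent \<delta> u v \<subseteq> {x. w \<bullet> x > 0}"
  unfolding bent_def using assms by (intro Un_least closed_segment_subset convex_halfspace_gt) auto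

text \<open>The line through the origin with normal \<open>w\<close> separates the two arcs.\<close>

lemma two_arcs_bent:
  assumes "\<delta> > 0" "w \<bullet> a > 0" "w \<bullet> b > 0" "w \<bullet> c < 0" "w \<bullet> d < 0"
  shows "two_arcs 0 (bent \<delta> a b \<union> bent \<delta> c d) a b c d"
proof -
  have "bent \<delta> a b \<subseteq> {x. w \<bullet> x > 0}" using assms by (intro bent_positive)
  moreover have "bent \<delta> c d \<subseteq> {x. (- w) \<bullet> x > 0}" using assms by (intro bent_positive) auto
  ultimately have dis: "bent \<delta> a b \<inter> bent \<delta> c d = {}" by fastforce
  have mem: "u \<in> bent \<delta> u v" "v \<in> bent \<delta> u v" for u v by (simp_all add: bent_def)
  then have "bent \<delta> a b \<noteq> bent \<delta> c d" using dis by blast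
  then have "parts [bent \<delta> a b, bent \<delta> c d] (bent \<delta> a b \<union> bent \<delta> c d)"
    using dis mem(1)[of a b] mem(1)[of c d]
    by (auto simp add: parts_def disjoint_def Int_commute compact_bent connected_bent)
  then show ?thesis by (rule two_arcsI) (auto simp: mem)
qed

lemma state_type_crossing_tangle:
  "state_type crossing_tangle \<sigma> (0 \<notin> \<sigma>) 0"
proof -
  have "\<forall>\<^sub>F \<epsilon> in at_right 0. 0 < \<epsilon> \<and> \<epsilon> < sqrt 2"
    unfolding eventually_at_right_field by (intro exI[of _ "sqrt 2"]) auto
  then show ?thesis
    unfolding state_type_def
  proof eventually_elim
    case (elim \<epsilon>)
    then have "\<epsilon> / sqrt 2 > 0" by simp
    then have "two_arcs 0 (bent (\<epsilon> / sqrt 2) NW SW \<union> bent (\<epsilon> / sqrt 2) NE SE) NW SW NE SE"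
      "two_arcs 0 (bent (\<epsilon> / sqrt 2) NW NE \<union> bent (\<epsilon> / sqrt 2) SW SE) NW NE SW SE"
      \<comment> \<open>Normal -1 separates left from right, normal \<open>\<i>\<close> separates
        above from below.\<close>
      using two_arcs_bent[of "\<epsilon> / sqrt 2" "-1" NW SW NE SE] two_arcs_bent[of "\<epsilon> / sqrt 2" \<i> NW NE SW SE]
      by (simp_all add: inner_complex_def)
    then show ?case using elim by (simp add: split_crossing_tangle)
  qed
qed

text \<open>The \<open>A\<close>-splitting has weight \<omega> and the other one its inverse. With
  phase \<open>inverse \<omega>\<close> the first entry is 1, and so is the second, since \<omega>
  squares to \<open>\<i>\<close>.\<close>

lemma realizes_crossing_tangle: "realizes crossing_tangle 1 1"
proof -
  define \<omega> where "\<omega> = exp (\<i> * of_real pi / 4)"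
  have \<omega>: "\<omega> \<noteq> 0" "\<omega> ^ 2 = \<i>"
  proof -
    have "\<omega> ^ 2 = exp (2 * (\<i> * of_real pi / 4))" unfolding \<omega>_def by (rule exp_double[symmetric])
    also have "\<dots> = cis (pi / 2)" by (simp add: cis_conv_exp)
    finally show "\<omega> ^ 2 = \<i>" by simp
  qed (simp add: \<omega>_def)
  have \<omega>8: "\<omega> ^ 8 = 1" using arg_cong[OF \<omega>(2), of "\<lambda>x. x ^ 4"] by (simp add: power_mult[symmetric])
  have typed: "typed_tangle crossing_tangle"
    unfolding typed_tangle_def crossings_crossing_tangle
    using ball_tangle_crossing_tangle state_type_crossing_tangle by auto
  have "state_type crossing_tangle \<sigma> h 0 \<longleftrightarrow> h = (0 \<notin> \<sigma>)" for \<sigma> h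
    using state_type_crossing_tangle[of \<sigma>] state_type_unique[OF state_type_crossing_tangle[of \<sigma>], of h 0]
    by auto
  then have "{\<sigma>. \<sigma> \<subseteq> crossings crossing_tangle \<and> state_type crossing_tangle \<sigma> True 0} = {{}}"
    "{\<sigma>. \<sigma> \<subseteq> crossings crossing_tangle \<and> state_type crossing_tangle \<sigma> False 0} = {{0}}"
    by (auto simp: crossings_crossing_tangle subset_singleton_iff)
  then have "type_sum crossing_tangle True = inverse \<omega>" "type_sum crossing_tangle False = \<omega>"
    by (simp_all add: type_sum_def weight_def crossings_crossing_tangle \<omega>_def[symmetric] power_int_minus)
  moreover have "inverse \<omega> ^ 8 = 1" using \<omega>8 by (simp add: power_inverse)
  moreover have "\<i> * inverse \<omega> * inverse \<omega> = 1"
    using \<omega> by (simp add: field_simps power2_eq_square)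
  ultimately show ?thesis
    unfolding realizes_def using typed \<omega>(1) by (intro conjI exI[of _ "inverse \<omega>"]) simp_all
qed

section \<open>Connecting two tangles\<close>

interpretation left: similarity "1/4" "- (1/2)" by unfold_locales simp
interpretation right: similarity "1/4" "1/2" by unfold_locales simp

lemma left_sel [simp]: "Re (left.f z) = Re z / 4 - 1/2" "Im (left.f z) = Im z / 4"
  by (simp_all add: left.f_def)

lemma right_sel [simp]: "Re (right.f z) = Re z / 4 + 1/2" "Im (right.f z) = Im z / 4"
  by (simp_all add: right.f_def)

abbreviation "left_disc \<equiv> cball (- (1/2) :: complex) (sqrt 2 / 4)"
abbreviation "right_disc \<equiv> cball (1/2 :: complex) (sqrt 2 / 4)"

text \<open>The copies are scaled by 1/4, so their discs have radius sqrt 2 / 4 < 3/8 and, being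
  centred at -1/2 and 1/2, stay away from the imaginary axis.\<close>

lemma sqrt2_bound: "sqrt 2 < 3/2"
  by (rule real_less_lsqrt) (simp_all add: power2_eq_square)

lemma left_disc_Re: "z \<in> left_disc \<Longrightarrow> Re z < 0"
  using abs_Re_le_cmod[of "- (1/2) - z"] sqrt2_bound by (simp add: dist_norm)

lemma right_disc_Re: "z \<in> right_disc \<Longrightarrow> Re z > 0"
  using abs_Re_le_cmod[of "1/2 - z"] sqrt2_bound by (simp add: dist_norm)

lemma discs_disjoint: "left_disc \<inter> right_disc = {}"
  using left_disc_Re right_disc_Re by fastforce

lemma disc_norm: "z \<in> left_disc \<union> right_disc \<Longrightarrow> norm z < sqrt 2"
proof -
  assume "z \<in> left_disc \<union> right_disc"
  then have "dist (- (1/2)) z \<le> sqrt 2 / 4 \<or> dist (1/2) z \<le> sqrt 2 / 4" by simp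
  moreover have "norm (- (1/2) :: complex) = 1/2" "norm (1/2 :: complex) = 1/2" by simp_all
  ultimately obtain c :: complex where c: "norm c = 1/2" "dist c z \<le> sqrt 2 / 4" by metis
  have "norm z \<le> norm c + dist c z" by (metis dist_0_norm dist_triangle)
  moreover have "1 < sqrt 2" by simp
  ultimately show ?thesis using c by linarith
qed

lemma left_disc_image: "z \<in> cball 0 (sqrt 2) \<Longrightarrow> left.f z \<in> left_disc"
  using left.dist_f[of 0 z] by (simp add: left.f_def[of 0])

lemma right_disc_image: "z \<in> cball 0 (sqrt 2) \<Longrightarrow> right.f z \<in> right_disc"
  using right.dist_f[of 0 z] by (simp add: right.f_def[of 0])

text \<open>
  The connecting strands are indexed by their height \<open>s\<close> (1 above and -1 below the real axis) and
  their column \<open>c\<close> (-1, 0, 1 from left to right).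
\<close>

definition start :: "real \<Rightarrow> real \<Rightarrow> complex" where
  "start s c = (if c = 0 then Complex (-1/4) (s/4) else Complex c s)"

definition stop :: "real \<Rightarrow> real \<Rightarrow> complex" where
  "stop s c = (if c = 0 then Complex (1/4) (s/4) else Complex (3*c/4) (s/4))"

definition strand :: "real \<Rightarrow> real \<Rightarrow> complex set" where
  "strand s c = closed_segment (start s c) (stop s c)"

definition indices :: "(real \<times> real) set" where
  "indices = {1, -1} \<times> {-1, 0, 1}"

definition connectors :: diagram where
  "connectors = \<lparr>edges = (\<lambda>(s, c). {start s c, stop s c}) ` indices, over = (\<lambda>_. {})\<rparr>"

lemma hull_strand: "convex hull {start s c, stop s c} = strand s c"
  by (simp add: strand_def segment_convex_hull)

text \<open>Half-plane and column identify a strand: columns are 1 apart, and a strand strays by at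
  most 1/4 from its own.\<close>

lemma strand_cell:
  assumes "(s, c) \<in> indices" "z \<in> strand s c"
  shows "s * Im z > 0" "\<bar>Re z - c\<bar> \<le> 1/4"
  using assms(1) segment_box[OF assms(2)[unfolded strand_def]]
  by (auto simp: indices_def start_def stop_def)

lemma strands_disjoint:
  assumes "i \<in> indices" "j \<in> indices" "i \<noteq> j"
  shows "case_prod strand i \<inter> case_prod strand j = {}"
proof (rule ccontr)
  obtain s c t d where ij: "i = (s, c)" "j = (t, d)" by (metis surj_pair)
  assume "case_prod strand i \<inter> case_prod strand j \<noteq> {}"
  then obtain z where z: "z \<in> strand s c" "z \<in> strand t d" using ij by auto
  then have "s * Im z > 0" "t * Im z > 0" "\<bar>Re z - c\<bar> \<le> 1/4" "\<bar>Re z - d\<bar> \<le> 1/4"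
    using strand_cell assms ij by auto
  then have "\<bar>c - d\<bar> \<le> 1/2" "s * Im z > 0" "t * Im z > 0" by linarith+
  then have "s = t" "\<bar>c - d\<bar> \<le> 1/2" using assms(1,2) ij by (auto simp: indices_def)
  moreover from this have "c = d" using assms(1,2) ij by (auto simp: indices_def)
  ultimately show False using assms(3) ij by simp
qed

lemma start_ne_stop: "(s, c) \<in> indices \<Longrightarrow> start s c \<noteq> stop s c"
  by (auto simp: indices_def start_def stop_def)

lemma connectors_edges:
  assumes "e \<in> edges connectors" "e' \<in> edges connectors" "e \<noteq> e'"
  shows "convex hull e \<inter> convex hull e' = {}"
proof -
  obtain s c t d where ij: "(s, c) \<in> indices" "(t, d) \<in> indices"
    "e = {start s c, stop s c}" "e' = {start t d, stop t d}"
    using assms(1,2) by (auto simp: connectors_def)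
  then have "(s, c) \<noteq> (t, d)" using assms(3) by auto
  then show ?thesis using strands_disjoint[OF ij(1,2)] ij by (simp add: hull_strand)
qed

lemma regular_connectors: "regular_diagram connectors" and crossings_connectors: "crossings connectors = {}"
proof -
  have "finite (edges connectors)" by (simp add: connectors_def indices_def)
  moreover have "card e = 2" if "e \<in> edges connectors" for e
    using that start_ne_stop by (auto simp: connectors_def)
  moreover have "pairwise (\<lambda>e e'. convex hull e \<inter> convex hull e' \<subseteq> e \<inter> e') (edges connectors)"
    using connectors_edges by (auto simp: pairwise_def)
  ultimately show "regular_diagram connectors" "crossings connectors = {}"
    using embedded_diagram by blast+
qed

lemma valency_connectors: "v \<in> \<Union>(edges connectors) \<Longrightarrow> valency connectors v = 1"
proof (rule valency_disjoint)
  have "e \<inter> e' \<subseteq> convex hull e \<inter> convex hull e'" for e e' :: "complex set"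
    by (meson Int_mono hull_subset)
  then show "disjoint (edges connectors)"
    unfolding disjoint_def by (metis connectors_edges subset_empty)
qed

lemma curve_connectors: "curve connectors = (\<Union>(s, c)\<in>indices. strand s c)"
  by (auto simp: curve_def connectors_def hull_strand)

lemma left_corner_strands [simp]:
  "stop 1 (-1) = left.f NW" "stop (-1) (-1) = left.f SW" "start 1 0 = left.f NE" "start (-1) 0 = left.f SE"
  by (simp_all add: start_def stop_def complex_eq_iff)

lemma right_corner_strands [simp]:
  "stop 1 0 = right.f NW" "stop (-1) 0 = right.f SW" "stop 1 1 = right.f NE" "stop (-1) 1 = right.f SE"
  by (simp_all add: start_def stop_def complex_eq_iff)

lemma outer_corner_strands [simp]:
  "start 1 (-1) = NW" "start (-1) (-1) = SW" "start 1 1 = NE" "start (-1) 1 = SE"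
  by (simp_all add: start_def complex_eq_iff)

lemma vertices_connectors: "\<Union>(edges connectors) = corners \<union> left.f ` corners \<union> right.f ` corners"
  by (simp add: connectors_def indices_def corners_def) blast

lemma corner_disc [simp]: "v \<in> corners \<Longrightarrow> v \<in> cball 0 (sqrt 2)"
  by (auto simp: corners_def)

lemma corner_dist:
  "v \<in> corners \<Longrightarrow> dist (- (1/2)) (left.f v) = sqrt 2 / 4"
  "v \<in> corners \<Longrightarrow> dist (1/2) (right.f v) = sqrt 2 / 4"
  using left.dist_f[of 0 v] right.dist_f[of 0 v]
  by (auto simp: corners_def left.f_def[of 0] right.f_def[of 0])

lemma strand_left_disc:
  "s \<in> {1, -1} \<Longrightarrow> strand s (-1) \<inter> left_disc = {stop s (-1)}"
  "s \<in> {1, -1} \<Longrightarrow> strand s 0 \<inter> left_disc = {start s 0}"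
  "s \<in> {1, -1} \<Longrightarrow> strand s 1 \<inter> left_disc = {}"
proof -
  assume s: "s \<in> {1, -1 :: real}"
  show "strand s (-1) \<inter> left_disc = {stop s (-1)}"
    unfolding strand_def closed_segment_commute[of "start s (-1)"]
    using s by (intro segment_leaves_cball) (auto simp: inner_complex_def corner_dist corners_def)
  show "strand s 0 \<inter> left_disc = {start s 0}"
    unfolding strand_def
    using s by (intro segment_leaves_cball) (auto simp: inner_complex_def corner_dist corners_def)
  have "(s, 1) \<in> indices" using s by (simp add: indices_def)
  then show "strand s 1 \<inter> left_disc = {}"
    using strand_cell(2) left_disc_Re by fastforce
qed

lemma strand_right_disc:
  "s \<in> {1, -1} \<Longrightarrow> strand s 1 \<inter> right_disc = {stop s 1}"
  "s \<in> {1, -1} \<Longrightarrow> strand s 0 \<inter> right_disc = {stop s 0}"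
  "s \<in> {1, -1} \<Longrightarrow> strand s (-1) \<inter> right_disc = {}"
proof -
  assume s: "s \<in> {1, -1 :: real}"
  show "strand s 1 \<inter> right_disc = {stop s 1}"
    unfolding strand_def closed_segment_commute[of "start s 1"]
    using s by (intro segment_leaves_cball) (auto simp: inner_complex_def corner_dist corners_def)
  show "strand s 0 \<inter> right_disc = {stop s 0}"
    unfolding strand_def closed_segment_commute[of "start s 0"]
    using s by (intro segment_leaves_cball) (auto simp: inner_complex_def corner_dist corners_def)
  have "(s, -1) \<in> indices" using s by (simp add: indices_def)
  then show "strand s (-1) \<inter> right_disc = {}"
    using strand_cell(2) right_disc_Re by fastforce
qed

text \<open>Strands touch a small disc only in their own endpoints, which are corners of the copy;
  this makes them compatible with a copy of any tangle.\<close>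

lemma connectors_meet_disc:
  assumes "e \<in> edges connectors" "x \<in> convex hull e"
  shows "x \<in> left_disc \<Longrightarrow> x \<in> e \<inter> left.f ` corners"
    "x \<in> right_disc \<Longrightarrow> x \<in> e \<inter> right.f ` corners"
proof -
  obtain s c where i: "(s, c) \<in> indices" "e = {start s c, stop s c}"
    using assms(1) by (auto simp: connectors_def)
  have s: "s \<in> {1, -1}" and c: "c = -1 \<or> c = 0 \<or> c = 1" using i(1) by (auto simp: indices_def)
  have x: "x \<in> strand s c" using assms(2) i(2) by (simp add: hull_strand)
  show "x \<in> e \<inter> left.f ` corners" if "x \<in> left_disc"
    using c
  proof (elim disjE)
    assume "c = -1"
    then have "x = stop s (-1)" using strand_left_disc(1)[OF s] x that by blast
    then show ?thesis using s \<open>c = -1\<close> by (auto simp: i corners_def)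
  next
    assume "c = 0"
    then have "x = start s 0" using strand_left_disc(2)[OF s] x that by blast
    then show ?thesis using s \<open>c = 0\<close> by (auto simp: i corners_def)
  next
    assume "c = 1"
    then show ?thesis using strand_left_disc(3)[OF s] x that by blast
  qed
  show "x \<in> e \<inter> right.f ` corners" if "x \<in> right_disc"
    using c
  proof (elim disjE)
    assume "c = 1"
    then have "x = stop s 1" using strand_right_disc(1)[OF s] x that by blast
    then show ?thesis using s \<open>c = 1\<close> by (auto simp: i corners_def)
  next
    assume "c = 0"
    then have "x = stop s 0" using strand_right_disc(2)[OF s] x that by blast
    then show ?thesis using s \<open>c = 0\<close> by (auto simp: i corners_def)
  next
    assume "c = -1"
    then show ?thesis using strand_right_disc(3)[OF s] x that by blast
  qed
qed

lemma compact_strand: "compact (strand s c)" and connected_strand: "connected (strand s c)"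
  by (auto simp: strand_def)

text \<open>\<open>two_arcs_extend\<close> moves only the first end, hence the permutations. Mutual
  disjointness of the tails keeps each new contact a single point.\<close>

lemma two_arcs_extend_all:
  assumes S: "two_arcs k S a b c d"
    and A: "compact A" "connected A" "A \<inter> S = {a}" "a' \<in> A"
    and B: "compact B" "connected B" "B \<inter> S = {b}" "b' \<in> B"
    and C: "compact C" "connected C" "C \<inter> S = {c}" "c' \<in> C"
    and D: "compact D" "connected D" "D \<inter> S = {d}" "d' \<in> D"
    and dis: "A \<inter> B = {}" "A \<inter> C = {}" "A \<inter> D = {}" "B \<inter> C = {}" "B \<inter> D = {}" "C \<inter> D = {}"
  shows "two_arcs k (S \<union> A \<union> B \<union> C \<union> D) a' b' c' d'"
proof -
  have B': "B \<inter> (S \<union> A) = {b}" using B(3) dis(1) by blast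
  have C': "C \<inter> (S \<union> A \<union> B) = {c}" using C(3) dis(2,4) by blast
  have D': "D \<inter> (S \<union> A \<union> B \<union> C) = {d}" using D(3) dis(3,5,6) by blast
  have "two_arcs k (S \<union> A) a' b c d" by (rule two_arcs_extend[OF S A])
  then have "two_arcs k (S \<union> A) b a' c d" by (rule two_arcs_reverse)
  then have "two_arcs k (S \<union> A \<union> B) b' a' c d" by (rule two_arcs_extend[OF _ B(1,2) B' B(4)])
  then have "two_arcs k (S \<union> A \<union> B) c d a' b'" by (rule two_arcs_reverse(2)[OF two_arcs_swap])
  then have "two_arcs k (S \<union> A \<union> B \<union> C) c' d a' b'" by (rule two_arcs_extend[OF _ C(1,2) C' C(4)])
  then have "two_arcs k (S \<union> A \<union> B \<union> C) d c' a' b'" by (rule two_arcs_reverse)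
  then have "two_arcs k (S \<union> A \<union> B \<union> C \<union> D) d' c' a' b'"
    by (rule two_arcs_extend[OF _ D(1,2) D' D(4)])
  then have "two_arcs k (S \<union> A \<union> B \<union> C \<union> D) c' d' a' b'" by (rule two_arcs_reverse)
  then show ?thesis by (rule two_arcs_swap)
qed

text \<open>The two middle strands decide the type and the possible extra circle; the outer four
  merely carry the ends to the corners of the large disc.\<close>

lemma two_arcs_sum:
  assumes S: "two_arcs k S (left.f NW) (left.f (if h then NE else SW)) (left.f (if h then SW else NE)) (left.f SE)"
    and T: "two_arcs l T (right.f NW) (right.f (if g then NE else SW)) (right.f (if g then SW else NE)) (right.f SE)"
    and discs: "S \<subseteq> left_disc" "T \<subseteq> right_disc"
  shows "two_arcs (if h \<or> g then k + l else Suc (k + l)) (S \<union> T \<union> curve connectors)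
    NW (if h \<and> g then NE else SW) (if h \<and> g then SW else NE) SE"
proof -
  let ?n = "if h \<or> g then k + l else Suc (k + l)"
  let ?M = "strand 1 0" and ?N = "strand (-1) 0"
  let ?U = "S \<union> T \<union> (?M \<union> ?N)"
  have ST: "S \<inter> T = {}" using discs discs_disjoint by blast
  have memS: "left.f NW \<in> S" "left.f NE \<in> S" "left.f SW \<in> S" "left.f SE \<in> S"
    using two_arcs_mem[OF S] by (auto split: if_splits)
  have memT: "right.f NW \<in> T" "right.f NE \<in> T" "right.f SW \<in> T" "right.f SE \<in> T"
    using two_arcs_mem[OF T] by (auto split: if_splits)
  have capt: "L \<inter> (S \<union> T) = P \<union> Q"
    if "L \<inter> left_disc = P" "L \<inter> right_disc = Q" "P \<subseteq> S" "Q \<subseteq> T" for L P Q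
    using that discs by blast
  have M: "?M \<inter> (S \<union> T) = {left.f NE, right.f NW}"
    using capt[OF strand_left_disc(2) strand_right_disc(2), of 1] memS memT by (simp add: insert_commute)
  have N: "?N \<inter> (S \<union> T) = {left.f SE, right.f SW}"
    using capt[OF strand_left_disc(2) strand_right_disc(2), of "-1"] memS memT by (simp add: insert_commute)
  have dis: "strand s c \<inter> strand t d = {}"
    if "(s, c) \<in> indices" "(t, d) \<in> indices" "(s, c) \<noteq> (t, d)" for s c t d
    using strands_disjoint[OF that] by simp
  have MN: "?M \<inter> ?N = {}" by (rule dis) (auto simp: indices_def)
  note cs = compact_strand connected_strand
  have "two_arcs ?n ?U (left.f NW) (if h \<and> g then right.f NE else left.f SW)
      (if h \<and> g then left.f SW else right.f NE) (right.f SE)"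
  proof (cases h; cases g)
    assume "h" "g"
    then show ?thesis using two_arcs_join_HH[OF _ _ ST cs M cs N MN] S T by simp
  next
    assume hg: "\<not> h" "g"
    then show ?thesis using two_arcs_join_VH[OF _ _ ST cs M cs N MN] S T by simp
  next
    assume hg: "h" "\<not> g"
    \<comment> \<open>Mirror image of the previous case: the vertical tangle is on the right, so
      \<open>S\<close> and \<open>T\<close> as well as left and right corners exchange
      roles.\<close>
    have S': "two_arcs k S (left.f NE) (left.f NW) (left.f SE) (left.f SW)"
      using S hg two_arcs_reverse by (simp; blast)
    have T': "two_arcs l T (right.f NE) (right.f SE) (right.f NW) (right.f SW)"
      using T hg two_arcs_swap by (simp; blast)
    have "two_arcs (l + k) (T \<union> S \<union> (?M \<union> ?N)) (right.f NE) (right.f SE) (left.f NW) (left.f SW)"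
      using ST M N MN by (intro two_arcs_join_VH[OF T' S' _ cs _ cs]) (auto simp: Un_commute insert_commute)
    then show ?thesis using two_arcs_swap hg by (simp add: Un_commute add.commute)
  next
    assume hg: "\<not> h" "\<not> g"
    then show ?thesis using two_arcs_join_VV[OF _ _ ST cs M cs N MN] S T by simp
  qed
  note core = this
  have outer: "strand s c \<inter> ?U = {stop s c}" if s: "s \<in> {1, -1}" and c: "c \<in> {-1, 1}" for s c
  proof -
    have i: "(s, c) \<in> indices" "c \<noteq> 0" using s c by (auto simp: indices_def)
    have "strand s c \<inter> (?M \<union> ?N) = {}"
      using dis[of s c 1 0] dis[of s c "-1" 0] i by (simp add: indices_def Int_Un_distrib)
    moreover have "strand s c \<inter> (S \<union> T) = {stop s c}"
      using c capt[OF strand_left_disc(1) strand_right_disc(3), of s] s memS memT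
        capt[OF strand_left_disc(3) strand_right_disc(1), of s] by auto
    ultimately show ?thesis by blast
  qed
  have start: "start s c \<in> strand s c" for s c by (simp add: strand_def)
  have idx: "(1, -1) \<in> indices" "(1, 1) \<in> indices" "(-1, -1) \<in> indices" "(-1, 1) \<in> indices"
    by (simp_all add: indices_def)
  have o: "strand 1 (-1) \<inter> ?U = {left.f NW}" "strand 1 1 \<inter> ?U = {right.f NE}"
    "strand (-1) (-1) \<inter> ?U = {left.f SW}" "strand (-1) 1 \<inter> ?U = {right.f SE}"
    using outer[of 1 "-1"] outer[of 1 1] outer[of "-1" "-1"] outer[of "-1" 1] by simp_all
  have m: "NW \<in> strand 1 (-1)" "NE \<in> strand 1 1" "SW \<in> strand (-1) (-1)" "SE \<in> strand (-1) 1"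
    using start[of 1 "-1"] start[of 1 1] start[of "-1" "-1"] start[of "-1" 1] by simp_all
  have d: "strand 1 (-1) \<inter> strand 1 1 = {}" "strand 1 (-1) \<inter> strand (-1) (-1) = {}"
    "strand 1 (-1) \<inter> strand (-1) 1 = {}" "strand 1 1 \<inter> strand (-1) (-1) = {}"
    "strand 1 1 \<inter> strand (-1) 1 = {}" "strand (-1) (-1) \<inter> strand (-1) 1 = {}"
    by (rule dis; simp add: idx)+
  have all: "S \<union> T \<union> curve connectors =
      ?U \<union> strand 1 (-1) \<union> strand 1 1 \<union> strand (-1) (-1) \<union> strand (-1) 1"
    by (auto simp: curve_connectors indices_def)
  show ?thesis
  proof (cases "h \<and> g")
    case True
    have "two_arcs ?n ?U (left.f NW) (right.f NE) (left.f SW) (right.f SE)" using core by (simp only: if_P[OF True])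
    from two_arcs_extend_all[OF this cs o(1) m(1) cs o(2) m(2) cs o(3) m(3) cs o(4) m(4) d]
    show ?thesis unfolding all by (simp only: if_P[OF True])
  next
    case False
    have "two_arcs ?n ?U (left.f NW) (left.f SW) (right.f NE) (right.f SE)" using core by (simp only: if_not_P[OF False])
    from two_arcs_extend_all[OF this cs o(1) m(1) cs o(3) m(3) cs o(2) m(2) cs o(4) m(4)]
    have "two_arcs ?n (?U \<union> strand 1 (-1) \<union> strand (-1) (-1) \<union> strand 1 1 \<union> strand (-1) 1) NW SW NE SE"
      using d by (simp add: Int_commute)
    moreover have "?U \<union> strand 1 (-1) \<union> strand (-1) (-1) \<union> strand 1 1 \<union> strand (-1) 1 =
        S \<union> T \<union> curve connectors" unfolding all by (simp only: Un_ac)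
    ultimately show ?thesis by (simp only: if_not_P[OF False])
  qed
qed

section \<open>Sums of tangles\<close>

locale tangle_sum =
  fixes B B' :: diagram
  assumes B: "typed_tangle B" and B': "typed_tangle B'"
begin

abbreviation "C \<equiv> left.transform B"
abbreviation "C' \<equiv> right.transform B'"

lemma tangles: "ball_tangle_diagram B" "ball_tangle_diagram B'"
  using B B' by (simp_all add: typed_tangle_def)

lemma regular_parts: "regular_diagram C" "regular_diagram C'"
  using tangles by (simp_all add: left.regular_transform right.regular_transform ball_tangle_regular)

lemma curves: "curve C \<subseteq> left_disc" "curve C' \<subseteq> right_disc"
  unfolding left.curve_transform right.curve_transform
  using curve_in_disc[OF tangles(1)] curve_in_disc[OF tangles(2)] left_disc_image right_disc_image by blast+

lemma hulls:
  "e \<in> edges C \<Longrightarrow> convex hull e \<subseteq> left_disc" "e \<in> edges C' \<Longrightarrow> convex hull e \<subseteq> right_disc"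
  using curves unfolding curve_def by blast+

lemma vertices: "\<Union>(edges C) \<subseteq> left_disc" "\<Union>(edges C') \<subseteq> right_disc"
  using hulls by (meson Union_least hull_subset subset_trans)+

sublocale inner: gluing C C'
proof
  show "compatible C C'"
    unfolding compatible_def using hulls discs_disjoint by blast
qed (fact regular_parts)+

sublocale outer: gluing "glue C C'" connectors
proof
  show "compatible (glue C C') connectors"
    unfolding compatible_def
  proof (intro ballI subsetI)
    fix e e' x
    assume e: "e \<in> edges (glue C C')" and e': "e' \<in> edges connectors"
      and x: "x \<in> convex hull e \<inter> convex hull e'"
    show "x \<in> e \<inter> e'"
    proof (cases "e \<in> edges C")
      case True
      then have "x \<in> left_disc" using hulls x by blast
      then have *: "x \<in> e' \<inter> left.f ` corners" using connectors_meet_disc(1)[OF e'] x by blast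
      obtain d where d: "d \<in> edges B" "e = left.f ` d" using True by auto
      obtain v where v: "v \<in> corners" "x = left.f v" using * by blast
      then have "v \<in> convex hull d" using x d by simp
      then have "v \<in> d" using corner_in_edge[OF tangles(1) d(1)] v by (simp add: corners_def)
      then show ?thesis using * d v by simp
    next
      case False
      then have e: "e \<in> edges C'" using e by simp
      then have "x \<in> right_disc" using hulls x by blast
      then have *: "x \<in> e' \<inter> right.f ` corners" using connectors_meet_disc(2)[OF e'] x by blast
      obtain d where d: "d \<in> edges B'" "e = right.f ` d" using e by auto
      obtain v where v: "v \<in> corners" "x = right.f v" using * by blast
      then have "v \<in> convex hull d" using x d by simp
      then have "v \<in> d" using corner_in_edge[OF tangles(2) d(1)] v by (simp add: corners_def)
      then show ?thesis using * d v by simp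
    qed
  qed
qed (fact inner.regular_glue regular_connectors)+

definition total :: diagram where
  "total = glue (glue C C') connectors"

lemma valency_total: "valency total v = valency C v + valency C' v + valency connectors v"
  by (simp add: total_def outer.valency_glue inner.valency_glue)

lemma valency_outside: "v \<notin> \<Union>(edges D) \<Longrightarrow> valency D v = 0"
proof -
  assume "v \<notin> \<Union>(edges D)"
  then have "{e \<in> edges D. v \<in> e} = {}" by blast
  then show ?thesis by (simp only: valency_def card.empty)
qed

lemma ball_tangle_valency:
  assumes "ball_tangle_diagram D" "v \<in> \<Union>(edges D)"
  shows "valency D v = (if v \<in> corners then 1 else 2)"
proof -
  have "\<forall>v\<in>\<Union>(edges D). (v \<in> corners \<longrightarrow> valency D v = 1) \<and>
      (v \<notin> corners \<longrightarrow> norm v < sqrt 2 \<and> valency D v = 2)"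
    using assms(1) unfolding ball_tangle_iff by (elim conjE)
  from bspec[OF this assms(2)] show ?thesis by simp
qed

lemma corner_not_in_disc: "v \<in> corners \<Longrightarrow> v \<notin> left_disc \<union> right_disc"
  using disc_norm[of v] by (auto simp: corners_def)

lemma ball_tangle_total: "ball_tangle_diagram total"
proof -
  have cB: "corners \<subseteq> \<Union>(edges B)" "corners \<subseteq> \<Union>(edges B')" using tangles by (simp_all add: ball_tangle_iff)
  have lr: "left.f ` corners \<subseteq> left_disc" "right.f ` corners \<subseteq> right_disc"
    using left_disc_image right_disc_image corner_disc by blast+
  \<comment> \<open>A corner of the copy has one edge inside and gains one strand; any other vertex
    has two edges inside and meets no strand.\<close>
  have two_left: "v \<notin> corners \<and> norm v < sqrt 2 \<and> valency total v = 2" if v: "v \<in> \<Union>(edges C)" for v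
  proof -
    obtain w where w: "w \<in> \<Union>(edges B)" "v = left.f w" using v unfolding left.vertices_transform by blast
    have disc: "v \<in> left_disc" using vertices v by blast
    then have nc: "v \<notin> corners" "norm v < sqrt 2" using corner_not_in_disc disc_norm by blast+
    have "v \<notin> \<Union>(edges C')" using disc vertices discs_disjoint by blast
    moreover have "v \<in> \<Union>(edges connectors) \<longleftrightarrow> w \<in> corners"
    proof -
      have "v \<notin> right.f ` corners" using lr(2) disc discs_disjoint by blast
      then show ?thesis unfolding vertices_connectors using nc by (simp add: w(2))
    qed
    then have "valency connectors v = (if w \<in> corners then 1 else 0)"
      using valency_connectors valency_outside by auto
    moreover have "valency C v = (if w \<in> corners then 1 else 2)"
      unfolding w(2) left.valency_transform using w(1) by (rule ball_tangle_valency[OF tangles(1)])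
    ultimately show ?thesis using nc by (simp add: valency_total valency_outside)
  qed
  have two_right: "v \<notin> corners \<and> norm v < sqrt 2 \<and> valency total v = 2" if v: "v \<in> \<Union>(edges C')" for v
  proof -
    obtain w where w: "w \<in> \<Union>(edges B')" "v = right.f w" using v unfolding right.vertices_transform by blast
    have disc: "v \<in> right_disc" using vertices v by blast
    then have nc: "v \<notin> corners" "norm v < sqrt 2" using corner_not_in_disc disc_norm by blast+
    have "v \<notin> \<Union>(edges C)" using disc vertices discs_disjoint by blast
    moreover have "v \<in> \<Union>(edges connectors) \<longleftrightarrow> w \<in> corners"
    proof -
      have "v \<notin> left.f ` corners" using lr(1) disc discs_disjoint by blast
      then show ?thesis unfolding vertices_connectors using nc by (simp add: w(2))
    qed
    then have "valency connectors v = (if w \<in> corners then 1 else 0)"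
      using valency_connectors valency_outside by auto
    moreover have "valency C' v = (if w \<in> corners then 1 else 2)"
      unfolding w(2) right.valency_transform using w(1) by (rule ball_tangle_valency[OF tangles(2)])
    ultimately show ?thesis using nc by (simp add: valency_total valency_outside)
  qed
  have one: "valency total v = 1" if v: "v \<in> corners" for v
  proof -
    have "v \<notin> \<Union>(edges C)" "v \<notin> \<Union>(edges C')" using v two_left two_right by blast+
    moreover have "v \<in> \<Union>(edges connectors)" using v vertices_connectors by simp
    ultimately have "valency C v = 0" "valency C' v = 0" "valency connectors v = 1"
      by (blast intro: valency_outside valency_connectors)+
    then show ?thesis by (simp add: valency_total)
  qed
  have V: "\<Union>(edges total) = \<Union>(edges C) \<union> \<Union>(edges C') \<union> corners"
  proof -
    have absorb: "X \<union> Y \<union> (K \<union> L \<union> R) = X \<union> Y \<union> K" if "L \<subseteq> X" "R \<subseteq> Y" for X Y K L R :: "complex set"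
      using that by blast
    have "left.f ` corners \<subseteq> \<Union>(edges C)" "right.f ` corners \<subseteq> \<Union>(edges C')"
      unfolding left.vertices_transform right.vertices_transform using cB by blast+
    moreover have "\<Union>(edges total) = \<Union>(edges C) \<union> \<Union>(edges C') \<union> \<Union>(edges connectors)"
      by (simp only: total_def edges_glue Union_Un_distrib)
    ultimately show ?thesis unfolding vertices_connectors by (simp only: absorb)
  qed
  show ?thesis
    unfolding ball_tangle_iff V
  proof (intro conjI ballI)
    fix v assume "v \<in> \<Union>(edges C) \<union> \<Union>(edges C') \<union> corners"
    then consider "v \<in> \<Union>(edges C)" | "v \<in> \<Union>(edges C')" | "v \<in> corners" by blast
    then have *: "v \<in> corners \<and> valency total v = 1 \<or>
        v \<notin> corners \<and> norm v < sqrt 2 \<and> valency total v = 2"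
      by cases (use two_left two_right one in \<open>simp_all only: simp_thms\<close>)
    show "v \<in> corners \<longrightarrow> valency total v = 1" using * by blast
    show "v \<notin> corners \<longrightarrow> norm v < sqrt 2 \<and> valency total v = 2" using * by blast
  qed (fact outer.regular_glue[folded total_def], blast)
qed

section \<open>States of a sum and their weights\<close>

definition joint :: "complex set \<Rightarrow> complex set \<Rightarrow> complex set" where
  "joint \<sigma> \<sigma>' = left.f ` \<sigma> \<union> right.f ` \<sigma>'"

lemma crossings_total: "crossings total = joint (crossings B) (crossings B')"
  by (simp add: total_def joint_def outer.crossings_glue inner.crossings_glue crossings_connectors
      left.crossings_transform right.crossings_transform)

lemma finite_parts: "finite (crossings B)" "finite (crossings B')"
  using B B' by (simp_all add: typed_tangle_def)

lemma joint_disjoint: "left.f ` crossings B \<inter> right.f ` crossings B' = {}"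
  using inner.crossings_disjoint by (simp add: left.crossings_transform right.crossings_transform)

lemma joint_restrict:
  assumes "\<sigma> \<subseteq> crossings B" "\<sigma>' \<subseteq> crossings B'"
  shows "joint \<sigma> \<sigma>' \<inter> left.f ` crossings B = left.f ` \<sigma>"
    "joint \<sigma> \<sigma>' \<inter> right.f ` crossings B' = right.f ` \<sigma>'"
  using joint_disjoint image_mono[OF assms(1), of left.f] image_mono[OF assms(2), of right.f]
  unfolding joint_def by blast+

lemma joint_inj: "inj_on (case_prod joint) (Pow (crossings B) \<times> Pow (crossings B'))"
proof (rule inj_onI)
  fix x y
  assume xy: "x \<in> Pow (crossings B) \<times> Pow (crossings B')" "y \<in> Pow (crossings B) \<times> Pow (crossings B')"
    "case_prod joint x = case_prod joint y"
  obtain s s' t t' where st: "x = (s, s')" "y = (t, t')" by (metis surj_pair)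
  then have sub: "s \<subseteq> crossings B" "s' \<subseteq> crossings B'" "t \<subseteq> crossings B" "t' \<subseteq> crossings B'"
    and eq: "joint s s' = joint t t'" using xy by auto
  have "left.f ` s = left.f ` t" "right.f ` s' = right.f ` t'"
    using joint_restrict[OF sub(1,2)] joint_restrict[OF sub(3,4)] unfolding eq by simp_all
  then show "x = y" using st by simp
qed

lemma subset_joint:
  "\<sigma> \<subseteq> crossings total \<longleftrightarrow> (\<exists>s\<subseteq>crossings B. \<exists>s'\<subseteq>crossings B'. \<sigma> = joint s s')"
proof
  assume "\<sigma> \<subseteq> crossings total"
  then have \<sigma>: "\<sigma> \<subseteq> left.f ` crossings B \<union> right.f ` crossings B'" by (simp add: crossings_total joint_def)
  obtain s where s: "s \<subseteq> crossings B" "\<sigma> \<inter> left.f ` crossings B = left.f ` s"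
    by (metis inf_le2 subset_image_iff)
  obtain s' where s': "s' \<subseteq> crossings B'" "\<sigma> \<inter> right.f ` crossings B' = right.f ` s'"
    by (metis inf_le2 subset_image_iff)
  have "\<sigma> = joint s s'" unfolding joint_def s(2)[symmetric] s'(2)[symmetric] using \<sigma> by blast
  then show "\<exists>s\<subseteq>crossings B. \<exists>s'\<subseteq>crossings B'. \<sigma> = joint s s'" using s s' by blast
next
  assume "\<exists>s\<subseteq>crossings B. \<exists>s'\<subseteq>crossings B'. \<sigma> = joint s s'"
  then show "\<sigma> \<subseteq> crossings total" unfolding crossings_total joint_def by blast
qed

text \<open>The exponent is the number of \<open>A\<close>-splittings minus that of
  \<open>B\<close>-splittings, and both numbers add up over the two disjoint sets of
  crossings.\<close>

lemma weight_joint: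
  assumes "\<sigma> \<subseteq> crossings B" "\<sigma>' \<subseteq> crossings B'"
  shows "weight total (joint \<sigma> \<sigma>') = weight B \<sigma> * weight B' \<sigma>'"
proof -
  have card: "card (joint s s') = card s + card s'" if "s \<subseteq> crossings B" "s' \<subseteq> crossings B'" for s s'
  proof -
    have "left.f ` s \<inter> right.f ` s' = {}" using that joint_disjoint by blast
    moreover have "finite s" "finite s'" using that finite_parts finite_subset by blast+
    ultimately show ?thesis unfolding joint_def by (subst card_Un_disjoint) auto
  qed
  have "crossings total - joint \<sigma> \<sigma>' = joint (crossings B - \<sigma>) (crossings B' - \<sigma>')"
  proof -
    have "left.f ` (crossings B - \<sigma>) = left.f ` crossings B - left.f ` \<sigma>"
      "right.f ` (crossings B' - \<sigma>') = right.f ` crossings B' - right.f ` \<sigma>'"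
      using left.inj_f right.inj_f by (simp_all add: image_set_diff)
    moreover have "left.f ` \<sigma> \<inter> right.f ` crossings B' = {}" "right.f ` \<sigma>' \<inter> left.f ` crossings B = {}"
      using joint_disjoint assms by blast+
    ultimately show ?thesis unfolding crossings_total joint_def by blast
  qed
  moreover have "exp (\<i> * of_real pi / 4) \<noteq> (0::complex)" by simp
  ultimately show ?thesis
    unfolding weight_def using assms by (simp add: card power_int_add[symmetric] algebra_simps)
qed

text \<open>Each factor sees only its own part of the state, so its split diagram is a similar copy
  of the original one and inherits its type.\<close>

lemma state_type_joint:
  assumes s: "s \<subseteq> crossings B" "state_type B s h k" and s': "s' \<subseteq> crossings B'" "state_type B' s' g l"
  shows "state_type total (joint s s') (h \<and> g) (if h \<or> g then k + l else Suc (k + l))"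
proof -
  let ?S = "split_diagram C (joint s s')" and ?T = "split_diagram C' (joint s s')"
  have S: "?S \<epsilon> = split_diagram C (left.f ` s) \<epsilon>" for \<epsilon>
    using joint_restrict(1)[OF s(1) s'(1)] image_mono[OF s(1), of left.f]
    by (intro split_diagram_cong) (auto simp: left.crossings_transform)
  have T: "?T \<epsilon> = split_diagram C' (right.f ` s') \<epsilon>" for \<epsilon>
    using joint_restrict(2)[OF s(1) s'(1)] image_mono[OF s'(1), of right.f]
    by (intro split_diagram_cong) (auto simp: right.crossings_transform)
  have fin: "finite (crossings C)" "finite (crossings C')" "finite (crossings (glue C C'))"
    using finite_parts by (simp_all add: inner.crossings_glue left.crossings_transform right.crossings_transform)
  have "\<forall>\<^sub>F \<epsilon> in at_right 0. split_diagram (glue C C') (joint s s') \<epsilon> = ?S \<epsilon> \<union> ?T \<epsilon>"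
    using fin by (intro inner.eventually_split_glue)
  moreover have "\<forall>\<^sub>F \<epsilon> in at_right 0. split_diagram total (joint s s') \<epsilon> =
      split_diagram (glue C C') (joint s s') \<epsilon> \<union> split_diagram connectors (joint s s') \<epsilon>"
    unfolding total_def using fin by (intro outer.eventually_split_glue) (simp_all add: crossings_connectors)
  moreover note left.eventually_two_arcs_transform[OF s(2)[unfolded state_type_def]]
    right.eventually_two_arcs_transform[OF s'(2)[unfolded state_type_def]]
  ultimately show ?thesis
    unfolding state_type_def
  proof eventually_elim
    case (elim \<epsilon>)
    have "?S \<epsilon> \<subseteq> left_disc" "?T \<epsilon> \<subseteq> right_disc"
      using split_diagram_subset[OF regular_parts(1) curves(1)] split_diagram_subset[OF regular_parts(2) curves(2)]
      by (simp_all only: convex_cball)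
    from two_arcs_sum[OF elim(3)[folded S] elim(4)[folded T] this]
    show ?case unfolding elim(2) elim(1) split_diagram_no_crossings[OF crossings_connectors] .
  qed
qed

lemma typed_tangle_total: "typed_tangle total"
proof -
  have "\<exists>h k. state_type total \<sigma> h k" if "\<sigma> \<subseteq> crossings total" for \<sigma>
    using that B B' state_type_joint unfolding subset_joint typed_tangle_def by metis
  then show ?thesis
    using ball_tangle_total finite_parts by (simp add: typed_tangle_def crossings_total joint_def)
qed

definition pure :: "bool \<Rightarrow> complex set set" where
  "pure h = {s. s \<subseteq> crossings B \<and> state_type B s h 0}"

definition pure' :: "bool \<Rightarrow> complex set set" where
  "pure' h = {s. s \<subseteq> crossings B' \<and> state_type B' s h 0}"

text \<open>A circle-free sum has circle-free factors, and two vertical factors are excluded by the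
  circle that forms between them.\<close>

lemma pure_total:
  "{\<sigma>. \<sigma> \<subseteq> crossings total \<and> state_type total \<sigma> True 0} = case_prod joint ` (pure True \<times> pure' True)"
  "{\<sigma>. \<sigma> \<subseteq> crossings total \<and> state_type total \<sigma> False 0} =
     case_prod joint ` (pure True \<times> pure' False \<union> pure False \<times> pure' True)"
proof -
  have iff: "state_type total (joint s s') f 0 \<longleftrightarrow>
      (f \<and> s \<in> pure True \<and> s' \<in> pure' True \<or>
       \<not> f \<and> (s \<in> pure True \<and> s' \<in> pure' False \<or> s \<in> pure False \<and> s' \<in> pure' True))"
    if s: "s \<subseteq> crossings B" "s' \<subseteq> crossings B'" for s s' f
  proof -
    obtain h k where h: "state_type B s h k" using B s by (auto simp: typed_tangle_def)
    obtain g l where g: "state_type B' s' g l" using B' s by (auto simp: typed_tangle_def)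
    have p: "s \<in> pure x \<longleftrightarrow> x = h \<and> k = 0" for x
      using s h state_type_unique[OF h, of x 0] by (auto simp: pure_def)
    have p': "s' \<in> pure' x \<longleftrightarrow> x = g \<and> l = 0" for x
      using s g state_type_unique[OF g, of x 0] by (auto simp: pure'_def)
    note j = state_type_joint[OF s(1) h s(2) g]
    have e: "state_type total (joint s s') f 0 \<longleftrightarrow> f = (h \<and> g) \<and> (if h \<or> g then k + l else Suc (k + l)) = 0"
    proof
      assume "state_type total (joint s s') f 0"
      from state_type_unique[OF j this]
      show "f = (h \<and> g) \<and> (if h \<or> g then k + l else Suc (k + l)) = 0" by blast
    qed (use j in \<open>elim conjE, simp only:\<close>)
    show ?thesis unfolding p p' e by (cases f; cases h; cases g) simp_all
  qed
  have sub: "s \<in> pure h \<Longrightarrow> s \<subseteq> crossings B" "s \<in> pure' h \<Longrightarrow> s \<subseteq> crossings B'" for s h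
    by (simp_all add: pure_def pure'_def)
  have joint_sub: "joint s s' \<subseteq> crossings total" if "s \<subseteq> crossings B" "s' \<subseteq> crossings B'" for s s'
    using that unfolding subset_joint by blast
  show "{\<sigma>. \<sigma> \<subseteq> crossings total \<and> state_type total \<sigma> True 0} = case_prod joint ` (pure True \<times> pure' True)"
  proof (intro equalityI subsetI)
    fix \<sigma> assume "\<sigma> \<in> {\<sigma>. \<sigma> \<subseteq> crossings total \<and> state_type total \<sigma> True 0}"
    then obtain s s' where "s \<subseteq> crossings B" "s' \<subseteq> crossings B'" "\<sigma> = joint s s'" "state_type total \<sigma> True 0"
      unfolding subset_joint by blast
    then show "\<sigma> \<in> case_prod joint ` (pure True \<times> pure' True)" using iff[of s s' True] by auto
  next
    fix \<sigma> assume "\<sigma> \<in> case_prod joint ` (pure True \<times> pure' True)"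
    then obtain s s' where s: "s \<in> pure True" "s' \<in> pure' True" "\<sigma> = joint s s'" by auto
    note ss = sub(1)[OF s(1)] sub(2)[OF s(2)]
    show "\<sigma> \<in> {\<sigma>. \<sigma> \<subseteq> crossings total \<and> state_type total \<sigma> True 0}"
      using iff[OF ss, of True] joint_sub[OF ss] s by simp
  qed
  show "{\<sigma>. \<sigma> \<subseteq> crossings total \<and> state_type total \<sigma> False 0} =
     case_prod joint ` (pure True \<times> pure' False \<union> pure False \<times> pure' True)"
  proof (intro equalityI subsetI)
    fix \<sigma> assume "\<sigma> \<in> {\<sigma>. \<sigma> \<subseteq> crossings total \<and> state_type total \<sigma> False 0}"
    then obtain s s' where "s \<subseteq> crossings B" "s' \<subseteq> crossings B'" "\<sigma> = joint s s'" "state_type total \<sigma> False 0"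
      unfolding subset_joint by blast
    then show "\<sigma> \<in> case_prod joint ` (pure True \<times> pure' False \<union> pure False \<times> pure' True)"
      using iff[of s s' False] by auto
  next
    fix \<sigma> assume "\<sigma> \<in> case_prod joint ` (pure True \<times> pure' False \<union> pure False \<times> pure' True)"
    then obtain s s' where s: "s \<in> pure True \<and> s' \<in> pure' False \<or> s \<in> pure False \<and> s' \<in> pure' True"
        "\<sigma> = joint s s'"
      by auto
    have ss: "s \<subseteq> crossings B" "s' \<subseteq> crossings B'" using s(1) sub by blast+
    show "\<sigma> \<in> {\<sigma>. \<sigma> \<subseteq> crossings total \<and> state_type total \<sigma> False 0}"
      using iff[OF ss, of False] joint_sub[OF ss] s by simp
  qed
qed

lemma sum_weight_joint:
  assumes "P \<subseteq> Pow (crossings B)" "Q \<subseteq> Pow (crossings B')"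
  shows "(\<Sum>x\<in>P \<times> Q. weight total (case_prod joint x)) = (\<Sum>s\<in>P. weight B s) * (\<Sum>s\<in>Q. weight B' s)"
proof -
  have "(\<Sum>x\<in>P \<times> Q. weight total (case_prod joint x)) = (\<Sum>(s, s')\<in>P \<times> Q. weight B s * weight B' s')"
    using assms by (intro sum.cong) (auto simp: weight_joint subset_iff)
  then show ?thesis by (simp add: sum_product sum.cartesian_product)
qed

text \<open>The absence of a product of the two vertical sums is what makes the formula that of
  adding fractions.\<close>

lemma type_sum_total:
  "type_sum total True = type_sum B True * type_sum B' True"
  "type_sum total False = type_sum B True * type_sum B' False + type_sum B False * type_sum B' True"
proof -
  have sub: "pure h \<subseteq> Pow (crossings B)" "pure' h \<subseteq> Pow (crossings B')" for h
    by (auto simp: pure_def pure'_def)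
  have fin: "finite (pure h)" "finite (pure' h)" for h
    using sub finite_parts by (meson finite_Pow_iff finite_subset)+
  have dis: "pure True \<inter> pure False = {}"
    unfolding pure_def using state_type_unique(1) by blast
  have P: "type_sum B h = (\<Sum>s\<in>pure h. weight B s)" "type_sum B' h = (\<Sum>s\<in>pure' h. weight B' s)" for h
    by (simp_all add: type_sum_def pure_def pure'_def)
  have reindex: "(\<Sum>\<sigma>\<in>case_prod joint ` X. weight total \<sigma>) = (\<Sum>x\<in>X. weight total (case_prod joint x))"
    if "X \<subseteq> Pow (crossings B) \<times> Pow (crossings B')" for X
    using inj_on_subset[OF joint_inj that] by (simp add: sum.reindex)
  show "type_sum total True = type_sum B True * type_sum B' True"
    unfolding type_sum_def[of total] pure_total
    by (subst reindex) (intro Sigma_mono sub, simp add: sum_weight_joint sub P)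
  have "type_sum total False =
      (\<Sum>x\<in>pure True \<times> pure' False \<union> pure False \<times> pure' True. weight total (case_prod joint x))"
    unfolding type_sum_def[of total] pure_total 
    by (rule reindex) (intro Un_least Sigma_mono sub)
  also have "\<dots> = (\<Sum>x\<in>pure True \<times> pure' False. weight total (case_prod joint x)) +
      (\<Sum>x\<in>pure False \<times> pure' True. weight total (case_prod joint x))"
    using dis fin by (intro sum.union_disjoint) auto
  finally show "type_sum total False = type_sum B True * type_sum B' False + type_sum B False * type_sum B' True"
    by (simp add: sum_weight_joint sub P)
qed

end

lemma realizes_sum:
  assumes "realizes B p q" "realizes B' r s"
  shows "\<exists>D. realizes D (p * s + q * r) (q * s)"
proof -
  interpret tangle_sum B B' using assms by unfold_locales (simp_all add: realizes_def)
  obtain z where z: "z ^ 8 = 1" "z * type_sum B False = of_int p" "\<i> * z * type_sum B True = of_int q"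
    using assms by (auto simp: realizes_def)
  obtain w where w: "w ^ 8 = 1" "w * type_sum B' False = of_int r" "\<i> * w * type_sum B' True = of_int s"
    using assms by (auto simp: realizes_def)
  \<comment> \<open>Each term of the first entry pairs a second entry, which carries a factor
    \<open>\<i>\<close>, with a first entry, which carries none.\<close>
  let ?u = "\<i> * z * w"
  have "?u * type_sum total False = (z * type_sum B False) * (\<i> * w * type_sum B' True) +
      (\<i> * z * type_sum B True) * (w * type_sum B' False)"
    by (simp add: type_sum_total algebra_simps)
  moreover have "\<i> * ?u * type_sum total True = (\<i> * z * type_sum B True) * (\<i> * w * type_sum B' True)"
    by (simp add: type_sum_total algebra_simps)
  moreover have "?u ^ 8 = 1" using z(1) w(1) by (simp add: power_mult_distrib)
  ultimately have "realizes total (p * s + q * r) (q * s)"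
    unfolding realizes_def using typed_tangle_total z w by (intro conjI exI[of _ ?u]) simp_all
  then show ?thesis ..
qed

section \<open>Euclid's algorithm on attained pairs\<close>

definition attained :: "int \<Rightarrow> int \<Rightarrow> bool" where
  "attained p q \<longleftrightarrow> (\<exists>B. realizes B p q)"

lemma attained_rotate: "attained p q \<Longrightarrow> attained q (- p)"
  unfolding attained_def using realizes_rotate by blast

lemma attained_uminus: "attained p q \<Longrightarrow> attained (- p) (- q)"
  using attained_rotate by blast

lemma attained_sum: "attained p q \<Longrightarrow> attained r s \<Longrightarrow> attained (p * s + q * r) (q * s)"
  unfolding attained_def using realizes_sum by blast

lemma attained_0_1: "attained 0 1" and attained_1_1: "attained 1 1"
  unfolding attained_def using realizes_zero_tangle realizes_crossing_tangle by blast+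

text \<open>One positive crossing sends (p, q) to (p + q, q), one negative crossing undoes
  this.\<close>

lemma attained_add_mult:
  assumes "attained p q"
  shows "attained (p + k * q) q"
proof (induction k rule: int_induct[where k = 0])
  case base
  then show ?case using assms by simp
next
  case (step1 i)
  then show ?case using attained_sum[OF step1(2) attained_1_1] by (simp add: algebra_simps)
next
  case (step2 i)
  \<comment> \<open>The negative crossing: (1, 1) rotates to (1, -1), whose negative is (-1,
    1).\<close>
  have "attained (-1) 1" using attained_uminus[OF attained_rotate[OF attained_1_1]] by simp
  then show ?case using attained_sum[OF step2(2), of "-1" 1] by (simp add: algebra_simps)
qed

lemma attained_zero: "attained p 0"
proof -
  have "attained 1 0" using attained_rotate[OF attained_rotate[OF attained_rotate[OF attained_0_1]]]
      attained_uminus[of "-1" 0] by simp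
  \<comment> \<open>The row of crossings is built with the opposite sign so that its quarter turn is
    (1, p).\<close>
  moreover have "attained (- p) 1" using attained_add_mult[OF attained_0_1, of "- p"] by simp
  then have "attained 1 p" using attained_rotate by fastforce
  ultimately show ?thesis using attained_sum[of 1 0 1 p] by simp
qed

text \<open>The second entry shrinks: the induction hypothesis is used for the pair with
  \<open>p mod q\<close> in second place, and a quarter turn then brings the remainder to the
  front.\<close>

lemma attained_all: "attained p q"
proof (induction "nat \<bar>q\<bar>" arbitrary: p q rule: less_induct)
  case less
  show ?case
  proof (cases "q = 0")
    case True
    then show ?thesis using attained_zero by simp
  next
    case False
    then have "nat \<bar>p mod q\<bar> < nat \<bar>q\<bar>" using abs_mod_less[of q p] by simp
    then have "attained (- q) (p mod q)" by (rule less)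
    then have "attained (p mod q) q" using attained_rotate by fastforce
    then show ?thesis using attained_add_mult[of "p mod q" q "p div q"] by simp
  qed
qed

theorem theorem4p4:
  fixes p q :: int
  shows "\<exists>B. ball_tangle_diagram B \<and> ball_tangle_invariant B = pm_class p q"
  using attained_all[of p q] realizes_invariant unfolding attained_def by blast

end
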